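(* Let $\beta=\mathrm{diag}(\beta_1,\dots,\beta_n)\in\mathbb{R}^{n\times n}$, $\gamma=\gamma^\top\in\mathbb{R}^{n\times n}$, $N\ge1$, and consider the Hamiltonian ODE problem, for $\mathbf{y}(t)\in\mathbb{R}^{2n\times(2N+1)}$, $$\dot{\mathbf{y}}=J\left[\beta_2\,\mathbf{y}D^2-\int_a^b\left[\gamma_2Q(\mathbf{y}\mathbf{w}(x))^2\right]\circ(\mathbf{y}\mathbf{w}(x))\,\mathbf{w}(x)^\top\,\mathrm{d}x\right]\equiv J\nabla H(\mathbf{y}),\quad t\in[0,T],\qquad\mathbf{y}(0)=\mathbf{y}^0,$$ with Hamiltonian $$H(\mathbf{y})=\frac12\sum_{j=0}^{2N}d_j^2\left(y_j^\top\beta_2y_j\right)-\frac18\int_a^b\left[Q(\mathbf{y}\mathbf{w}(x))^2\right]^\top\gamma_2\left[Q(\mathbf{y}\mathbf{w}(x))^2\right]\mathrm{d}x .$$ For all $s\ge1$, the HBVM$(2s,s)$ method, when applied for solving this problem, is energy-conserving (i.e. each step $\mathbf{y}^0\mapsto\mathbf{y}^1$ of the method satisfies $H(\mathbf{y}^1)=H(\mathbf{y}^0)$) and has order $2s$.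
   Context: Notation for the problem: $\circ$ is the componentwise product, $v^2=v\circ v$ for a vector $v$; $\mathbf{y}=(y_0,\dots,y_{2N})$ has columns $y_j\in\mathbb{R}^{2n}$; $I_r$ is the $r\times r$ identity; $J_2=\begin{pmatrix}0&1\\-1&0\end{pmatrix}$; $\beta_2=\beta\otimes I_2$, $\gamma_2=\gamma\otimes I_2$, $J=I_n\otimes J_2$, $Q=I_n\otimes\begin{pmatrix}1&1\\1&1\end{pmatrix}$. $\mathbf{w}(x)=(w_0(x),\dots,w_{2N}(x))^\top$ with $w_0(x)=\frac{1}{\sqrt{b-a}}$, $w_{2j-1}(x)=\sqrt{\frac{2}{b-a}}\sin\left(2\pi j\frac{x-a}{b-a}\right)$, $w_{2j}(x)=\sqrt{\frac{2}{b-a}}\cos\left(2\pi j\frac{x-a}{b-a}\right)$, $j=1,\dots,N$. $D=\frac{2\pi}{b-a}\,\mathrm{diag}(0,\,1\cdot I_2,\dots,N\cdot I_2)$, with diagonal entries $d_j=\frac{2\pi}{b-a}\lceil\frac j2\rceil$, $j=0,\dots,2N$. $\nabla H(\mathbf{y})$ is the gradient arranged as a $2n\times(2N+1)$ matrix. HBVM$(k,s)$, $k\ge s$, is the $k$-stage Runge–Kutta method with abscissae vector $c=(c_1,\dots,c_k)^\top$, weight vector $b=(b_1,\dots,b_k)^\top$ equal to the abscissae (in $[0,1]$) and weights of the Gauss–Legendre quadrature formula of order $2k$, and Butcher matrix $\mathcal{I}_s\mathcal{P}_s^\top\Omega\in\mathbb{R}^{k\times k}$, where $\mathcal{P}_s=(P_{j-1}(c_i))\in\mathbb{R}^{k\times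 s}$, $\mathcal{I}_s=\left(\int_0^{c_i}P_{j-1}(x)\,\mathrm{d}x\right)\in\mathbb{R}^{k\times s}$ ($i=1,\dots,k$, $j=1,\dots,s$), $\Omega=\mathrm{diag}(b_1,\dots,b_k)$, and $P_0,P_1,\dots$ are the Legendre polynomials shifted to $[0,1]$ and scaled to be orthonormal: $\deg P_i=i$, $\int_0^1P_i(x)P_j(x)\,\mathrm{d}x=\delta_{ij}$. A step with stepsize $h$ (small enough for the stage equations to be solvable) reads $Y_i=\mathbf{y}^0+h\sum_{j}(\mathcal{I}_s\mathcal{P}_s^\top\Omega)_{ij}J\nabla H(Y_j)$, $\mathbf{y}^1=\mathbf{y}^0+h\sum_ib_iJ\nabla H(Y_i)$. Order $2s$ means $\mathbf{y}^1-\mathbf{y}(h)=O(h^{2s+1})$. *)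

theory Defs
  imports "HOL-Analysis.Analysis" "HOL-Computational_Algebra.Polynomial"
begin

text \<open>
  Index types: \<open>'n \<times> 2\<close> is the row index of the \<open>2n\<close>-dimensional space \<open>\<real>\<^sup>n \<otimes> \<real>\<^sup>2\<close> with
  \<open>n = CARD('n)\<close>, and \<open>'m bit1\<close> has exactly \<open>2 * CARD('m) + 1\<close> elements, represented by the
  integers \<open>0, \<dots>, 2N\<close> with \<open>N = CARD('m) \<ge> 1\<close>.  So \<open>real^('m bit1)^('n \<times> 2)\<close> is the space of
  real \<open>2n \<times> (2N+1)\<close> matrices.  On vectors, \<open>*\<close> and \<open>^\<close> are componentwise; the matrix product
  is \<open>**\<close>.
\<close>

definition diag_mat :: "real^'i::finite \<Rightarrow> real^'i^'i" where
  "diag_mat v = (\<chi> i j. if i = j then v $ i else 0)"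

definition kron :: "real^'j::finite^'i::finite \<Rightarrow> real^'l::finite^'k::finite \<Rightarrow> real^('j \<times> 'l)^('i \<times> 'k)"
  (infixl \<open>\<otimes>\<^sub>K\<close> 70) where
  "A \<otimes>\<^sub>K B = (\<chi> p q. A $ fst p $ fst q * B $ snd p $ snd q)"

definition outer :: "real^'i::finite \<Rightarrow> real^'j::finite \<Rightarrow> real^'j^'i" where
  "outer u v = (\<chi> i j. u $ i * v $ j)"

definition J2 :: "real^2^2" where
  "J2 = vector [vector [0, 1], vector [-1, 0]]"

definition Jmat :: "real^('n::finite \<times> 2)^('n \<times> 2)" where
  "Jmat = mat 1 \<otimes>\<^sub>K J2"

definition Qmat :: "real^('n::finite \<times> 2)^('n \<times> 2)" where
  "Qmat = mat 1 \<otimes>\<^sub>K (vector [vector [1, 1], vector [1, 1]] :: real^2^2)"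

definition tensor_I2 :: "real^'n::finite^'n \<Rightarrow> real^('n \<times> 2)^('n \<times> 2)" where
  "tensor_I2 A = A \<otimes>\<^sub>K (mat 1 :: real^2^2)"

definition col_index :: "'m::finite bit1 \<Rightarrow> nat" where
  "col_index j = nat (Rep_bit1 j)"

definition freq :: "'m::finite bit1 \<Rightarrow> real" where
  "freq j = real_of_int \<lceil>real (col_index j) / 2\<rceil>"

definition basis_w :: "real \<Rightarrow> real \<Rightarrow> real \<Rightarrow> real^('m::finite bit1)" where
  "basis_w a b x = (\<chi> j.
     if col_index j = 0 then 1 / sqrt (b - a)
     else if odd (col_index j)
       then sqrt (2 / (b - a)) * sin (2 * pi * freq j * ((x - a) / (b - a)))
       else sqrt (2 / (b - a)) * cos (2 * pi * freq j * ((x - a) / (b - a))))"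

definition dvec :: "real \<Rightarrow> real \<Rightarrow> real^('m::finite bit1)" where
  "dvec a b = (\<chi> j. 2 * pi / (b - a) * freq j)"

definition Dmat :: "real \<Rightarrow> real \<Rightarrow> real^('m::finite bit1)^('m bit1)" where
  "Dmat a b = diag_mat (dvec a b)"

definition hamiltonian ::
  "real^'n::finite^'n \<Rightarrow> real^'n^'n \<Rightarrow> real \<Rightarrow> real \<Rightarrow> real^('m::finite bit1)^('n \<times> 2) \<Rightarrow> real" where
  "hamiltonian \<beta> \<gamma> a b y =
     1/2 * (\<Sum>j\<in>UNIV. (dvec a b $ j)\<^sup>2 * (column j y \<bullet> (tensor_I2 \<beta> *v column j y)))
     - 1/8 * integral {a..b} (\<lambda>x.
         (Qmat *v (y *v basis_w a b x)\<^sup>2)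
           \<bullet> (tensor_I2 \<gamma> *v (Qmat *v (y *v basis_w a b x)\<^sup>2)))"

definition grad_hamiltonian ::
  "real^'n::finite^'n \<Rightarrow> real^'n^'n \<Rightarrow> real \<Rightarrow> real \<Rightarrow>
   real^('m::finite bit1)^('n \<times> 2) \<Rightarrow> real^('m bit1)^('n \<times> 2)" where
  "grad_hamiltonian \<beta> \<gamma> a b y =
     tensor_I2 \<beta> ** y ** (Dmat a b ** Dmat a b)
     - integral {a..b} (\<lambda>x.
         outer (((tensor_I2 \<gamma> ** Qmat) *v (y *v basis_w a b x)\<^sup>2) * (y *v basis_w a b x))
               (basis_w a b x))"

definition ham_field ::
  "real^'n::finite^'n \<Rightarrow> real^'n^'n \<Rightarrow> real \<Rightarrow> real \<Rightarrow>
   real^('m::finite bit1)^('n \<times> 2) \<Rightarrow> real^('m bit1)^('n \<times> 2)" where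
  "ham_field \<beta> \<gamma> a b y = Jmat ** grad_hamiltonian \<beta> \<gamma> a b y"

text \<open>The following determines each \<open>P i\<close> up to its sign, which does not affect the method.\<close>

definition orthonormal_legendre :: "(nat \<Rightarrow> real poly) \<Rightarrow> bool" where
  "orthonormal_legendre P \<longleftrightarrow>
     (\<forall>i. degree (P i) = i) \<and>
     (\<forall>i j. integral {0..1} (\<lambda>x. poly (P i) x * poly (P j) x) = (if i = j then 1 else 0))"

text \<open>
  The \<open>k\<close>-point Gauss--Legendre formula on \<open>[0,1]\<close>: its nodes are the \<open>k\<close> zeros of \<open>P k\<close>, listed
  increasingly, and its weights are the integrals of the Lagrange basis polynomials at these nodes.
\<close>

definition gauss_legendre ::
  "(nat \<Rightarrow> real poly) \<Rightarrow> nat \<Rightarrow> (nat \<Rightarrow> real) \<Rightarrow> (nat \<Rightarrow> real) \<Rightarrow> bool" where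
  "gauss_legendre P k c \<omega> \<longleftrightarrow>
     strict_mono_on {..<k} c \<and>
     (\<forall>i<k. c i \<in> {0..1} \<and> poly (P k) (c i) = 0) \<and>
     (\<forall>i<k. \<omega> i = integral {0..1} (\<lambda>x. \<Prod>j\<in>{..<k} - {i}. (x - c j) / (c i - c j)))"

definition hbvm_matrix ::
  "(nat \<Rightarrow> real poly) \<Rightarrow> (nat \<Rightarrow> real) \<Rightarrow> (nat \<Rightarrow> real) \<Rightarrow> nat \<Rightarrow> nat \<Rightarrow> nat \<Rightarrow> real" where
  "hbvm_matrix P c \<omega> s i j =
     (\<Sum>l<s. integral {0..c i} (poly (P l)) * poly (P l) (c j) * \<omega> j)"

definition rk_stages ::
  "nat \<Rightarrow> (nat \<Rightarrow> nat \<Rightarrow> real) \<Rightarrow> ('v::real_vector \<Rightarrow> 'v) \<Rightarrow> real \<Rightarrow> 'v \<Rightarrow> (nat \<Rightarrow> 'v) \<Rightarrow> bool" where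
  "rk_stages k A f h y0 Y \<longleftrightarrow> (\<forall>i<k. Y i = y0 + h *\<^sub>R (\<Sum>j<k. A i j *\<^sub>R f (Y j)))"

definition rk_update ::
  "nat \<Rightarrow> (nat \<Rightarrow> real) \<Rightarrow> ('v::real_vector \<Rightarrow> 'v) \<Rightarrow> real \<Rightarrow> 'v \<Rightarrow> (nat \<Rightarrow> 'v) \<Rightarrow> 'v" where
  "rk_update k \<omega> f h y0 Y = y0 + h *\<^sub>R (\<Sum>i<k. \<omega> i *\<^sub>R f (Y i))"

definition energy_conserving ::
  "nat \<Rightarrow> (nat \<Rightarrow> nat \<Rightarrow> real) \<Rightarrow> (nat \<Rightarrow> real) \<Rightarrow> ('v::real_vector \<Rightarrow> 'v) \<Rightarrow> ('v \<Rightarrow> real) \<Rightarrow> bool" where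
  "energy_conserving k A \<omega> f H \<longleftrightarrow>
     (\<forall>h>0. \<forall>y0 Y. rk_stages k A f h y0 Y \<longrightarrow> H (rk_update k \<omega> f h y0 Y) = H y0)"

text \<open>
  Order \<open>p\<close> of the method along the solution \<open>y\<close>: for small \<open>h > 0\<close> the stage equations are
  solvable near \<open>y 0\<close>, and the step starting at \<open>y 0\<close> has local error \<open>O(h\<^sup>p\<^sup>+\<^sup>1)\<close>.  The stage
  equations of an implicit method may have further solutions, which go off to infinity as
  \<open>h \<rightarrow> 0\<close>; hence the restriction to stages within an arbitrary, but fixed, distance \<open>R\<close> of \<open>y 0\<close>.
\<close>

definition rk_order ::
  "nat \<Rightarrow> (nat \<Rightarrow> nat \<Rightarrow> real) \<Rightarrow> (nat \<Rightarrow> real) \<Rightarrow> ('v::real_normed_vector \<Rightarrow> 'v) \<Rightarrow>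
   (real \<Rightarrow> 'v) \<Rightarrow> nat \<Rightarrow> bool" where
  "rk_order k A \<omega> f y p \<longleftrightarrow>
     (\<forall>R>0.
        (\<forall>\<^sub>F h in at_right 0.
           \<exists>Y. rk_stages k A f h (y 0) Y \<and> (\<forall>i<k. dist (Y i) (y 0) \<le> R)) \<and>
        (\<exists>C. \<forall>\<^sub>F h in at_right 0.
           \<forall>Y. rk_stages k A f h (y 0) Y \<and> (\<forall>i<k. dist (Y i) (y 0) \<le> R) \<longrightarrow>
               norm (rk_update k \<omega> f h (y 0) Y - y h) \<le> C * h ^ (p + 1)))"

end

theory Submission
  imports Defs
begin

text \<open>
  The equation is Hamiltonian with a quartic Hamiltonian \<open>H\<close>, hence with a cubic vector field
  \<open>f = J \<nabla>H\<close>.  The stages of a step are the values, at the Gauss--Legendre nodes, of a polynomial curve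
  \<open>u\<close> of degree \<open>s\<close>, in rescaled time on \<open>[0,1]\<close>, which starts at the old value and ends at the new one.
  The derivative of \<open>u\<close> is \<open>h\<close> times a combination of the Legendre polynomials of degree less than \<open>s\<close>
  whose coefficients are the quadrature values of the Legendre coefficients of \<open>f(u)\<close>.  All integrands
  that matter, namely the products of these Legendre polynomials with \<open>f(u)\<close> and the derivative of \<open>H(u)\<close>,
  are polynomials of degree at most \<open>4 s - 1\<close>, so that quadrature with \<open>2 s\<close> nodes is exact for them
  (\<open>gauss_legendre_exact\<close>).  Both assertions about the method follow from this.

  The energy is conserved because the change of \<open>H\<close> over the step, the integral of \<open>\<nabla>H(u) \<bullet> u'\<close>, equals
  a sum of terms \<open>g \<bullet> J g\<close> with the skew matrix \<open>J\<close> (\<open>hbvm_energy_conserving\<close>).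

  For the order, exactness means that \<open>u'\<close> is \<open>h\<close> times the \<open>L\<^sup>2\<close>-projection of \<open>f(u)\<close>, so that \<open>u\<close> is the
  Galerkin approximation of the solution (\<open>hbvm_curve_galerkin\<close>).  Its residual is only \<open>O(h\<^sup>s)\<close>, but it is
  orthogonal to all polynomials of degree less than \<open>s\<close>, and the pairing of it with any smooth function is
  therefore \<open>O(h\<^sup>2\<^sup>s)\<close>.  The classical proof carries this over to the endpoint error with the nonlinear
  variation-of-constants formula.  Here that formula is replaced by repeated integration by parts in the
  linear equation for the error \<open>u - y\<close> (\<open>galerkin_superconvergence\<close>), which has smooth coefficients since
  \<open>f\<close> is polynomial (\<open>polyfun_increment\<close>).  Smoothness uniformly in \<open>h\<close> is expressed by the expansions
  \<open>jet\<close>, which the integral equations for \<open>y\<close> and \<open>u\<close> provide (\<open>curve_jets\<close>).  That the stage equations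
  are solvable for small \<open>h\<close> is a fixed-point argument (\<open>rk_stages_solvable\<close>).

  The remaining part computes the gradient of \<open>H\<close> and the degrees of \<open>H\<close> and \<open>f\<close>; there the integral over
  space is that of a polynomial in the unknowns whose coefficients depend continuously on the space
  variable (\<open>param_polyfun\<close>).
\<close>

section \<open>Legendre polynomials and Gauss--Legendre quadrature\<close>

text \<open>
  The primitive of \<open>p\<close> vanishing at \<open>0\<close>, as a polynomial, so that degrees can be counted.
\<close>

definition antideriv :: "real poly \<Rightarrow> real poly" where
  "antideriv p = (\<Sum>i\<le>degree p. monom (coeff p i / real (Suc i)) (Suc i))"

lemma pderiv_antideriv [simp]: "pderiv (antideriv p) = p"
proof -
  have "pderiv (antideriv p) = (\<Sum>i\<le>degree p. monom (coeff p i) i)"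
    using higher_pderiv_sum[of 1 "\<lambda>i. monom (coeff p i / real (Suc i)) (Suc i)" "{..degree p}"]
    by (simp add: antideriv_def pderiv_monom del: of_nat_Suc)
  then show ?thesis by (simp add: poly_as_sum_of_monoms)
qed

lemma degree_antideriv: "degree (antideriv p) \<le> Suc (degree p)"
  unfolding antideriv_def
  by (intro degree_sum_le) (auto intro: order_trans[OF degree_monom_le])

lemma poly_antideriv_0 [simp]: "poly (antideriv p) 0 = 0"
  by (simp add: antideriv_def poly_sum poly_monom)

lemma has_integral_poly:
  "x \<le> y \<Longrightarrow> (poly p has_integral poly (antideriv p) y - poly (antideriv p) x) {x..y}"
  for p :: "real poly"
  by (rule fundamental_theorem_of_calculus)
     (auto simp: has_real_derivative_iff_has_vector_derivative[symmetric]
           intro!: derivative_eq_intros)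

lemma integral_poly_from_0: "0 \<le> x \<Longrightarrow> integral {0..x} (poly p) = poly (antideriv p) x"
  for p :: "real poly"
  using has_integral_poly[of 0 x p] by (simp add: integral_unique)

lemma continuous_on_poly_fun [continuous_intros]: "continuous_on A (poly p)"
  for p :: "real poly"
  by (intro continuous_intros)

lemma orthonormal_legendre_integral:
  assumes "orthonormal_legendre P"
  shows "integral {0..1} (\<lambda>x. poly (P i) x * poly (P j) x) = (if i = j then 1 else 0)"
  using assms by (auto simp: orthonormal_legendre_def)

lemma degree_legendre: "orthonormal_legendre P \<Longrightarrow> degree (P i) = i"
  by (auto simp: orthonormal_legendre_def)

lemma legendre_nonzero: assumes "orthonormal_legendre P" shows "P i \<noteq> 0"
  using orthonormal_legendre_integral[OF assms, of i i] by auto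

text \<open>
  The degrees of \<open>P 0, P 1, \<dots>\<close> are \<open>0, 1, \<dots>\<close>, so subtracting a multiple of \<open>P s\<close> removes
  the leading term.
\<close>

lemma legendre_span:
  assumes P: "orthonormal_legendre P"
  shows "degree q < s \<Longrightarrow> \<exists>a. q = (\<Sum>l<s. smult (a l) (P l))"
proof (induction s arbitrary: q)
  case 0
  then show ?case by simp
next
  case (Suc s)
  define r where "r = q - smult (coeff q s / coeff (P s) s) (P s)"
  have lc: "coeff (P s) s \<noteq> 0"
    using legendre_nonzero[OF P, of s] degree_legendre[OF P, of s] by (metis leading_coeff_0_iff)
  have cr: "coeff r i = 0" if "i \<ge> s" for i
  proof (cases "i = s")
    case True
    then show ?thesis using lc by (simp add: r_def)
  next
    case False
    then have "i > s" using that by simp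
    then show ?thesis using Suc.prems degree_legendre[OF P, of s]
      by (simp add: r_def coeff_eq_0)
  qed
  have "\<exists>a. r = (\<Sum>l<s. smult (a l) (P l))"
  proof (cases "r = 0")
    case True
    then show ?thesis by (intro exI[of _ "\<lambda>_. 0"]) simp
  next
    case False
    then have "degree r < s" using cr by (metis leading_coeff_0_iff not_le)
    then show ?thesis by (rule Suc.IH)
  qed
  then obtain a where a: "r = (\<Sum>l<s. smult (a l) (P l))" by blast
  define a' where "a' = a(s := coeff q s / coeff (P s) s)"
  have "(\<Sum>l<s. smult (a' l) (P l)) = r"
    unfolding a by (intro sum.cong) (auto simp: a'_def)
  then have "(\<Sum>l<Suc s. smult (a' l) (P l)) = q"
    by (simp add: a'_def r_def)
  then show ?case by metis
qed

lemma legendre_orthogonal_lower_degree: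
  assumes P: "orthonormal_legendre P" and q: "degree q < k"
  shows "integral {0..1} (\<lambda>x. poly q x * poly (P k) x) = 0"
proof -
  obtain a where a: "q = (\<Sum>l<k. smult (a l) (P l))"
    using legendre_span[OF P q] by blast
  have "integral {0..1} (\<lambda>x. poly q x * poly (P k) x)
      = integral {0..1} (\<lambda>x. \<Sum>l<k. a l *\<^sub>R (poly (P l) x * poly (P k) x))"
    by (simp add: a poly_sum sum_distrib_right mult.assoc)
  also have "\<dots> = (\<Sum>l<k. a l *\<^sub>R integral {0..1} (\<lambda>x. poly (P l) x * poly (P k) x))"
    by (subst integral_sum) (auto intro!: integrable_continuous_interval continuous_intros)
  also have "\<dots> = 0"
    by (intro sum.neutral) (auto simp: orthonormal_legendre_integral[OF P])
  finally show ?thesis .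
qed

text \<open>
  The \<open>L\<^sup>2\<close>-orthogonal projection onto the polynomials of degree less than \<open>s\<close>.
\<close>

definition legendre_proj :: "(nat \<Rightarrow> real poly) \<Rightarrow> nat \<Rightarrow> (real \<Rightarrow> real) \<Rightarrow> real poly" where
  "legendre_proj P s g = (\<Sum>l<s. smult (integral {0..1} (\<lambda>x. poly (P l) x * g x)) (P l))"

lemma legendre_proj_id:
  assumes P: "orthonormal_legendre P" and q: "degree q < s"
  shows "legendre_proj P s (poly q) = q"
proof -
  obtain a where a: "q = (\<Sum>l<s. smult (a l) (P l))"
    using legendre_span[OF P q] by blast
  have "integral {0..1} (\<lambda>x. poly (P l) x * poly q x) = a l" if "l < s" for l
  proof -
    have "integral {0..1} (\<lambda>x. poly (P l) x * poly q x)
        = integral {0..1} (\<lambda>x. \<Sum>j<s. a j *\<^sub>R (poly (P l) x * poly (P j) x))"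
      by (simp add: a poly_sum sum_distrib_left mult_ac)
    also have "\<dots> = (\<Sum>j<s. a j *\<^sub>R integral {0..1} (\<lambda>x. poly (P l) x * poly (P j) x))"
      by (subst integral_sum) (auto intro!: integrable_continuous_interval continuous_intros)
    also have "\<dots> = (\<Sum>j<s. if l = j then a j else 0)"
      by (intro sum.cong) (auto simp: orthonormal_legendre_integral[OF P])
    also have "\<dots> = a l" using that by simp
    finally show ?thesis .
  qed
  then have "legendre_proj P s (poly q) = (\<Sum>l<s. smult (a l) (P l))"
    unfolding legendre_proj_def by (intro sum.cong) auto
  then show ?thesis using a by simp
qed

lemma degree_legendre_proj:
  assumes "orthonormal_legendre P" "s \<ge> 1"
  shows "degree (legendre_proj P s g) < s"
proof -
  have "degree (legendre_proj P s g) \<le> s - 1"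
    unfolding legendre_proj_def
    by (intro degree_sum_le)
       (auto simp: degree_legendre[OF assms(1)] intro: order_trans[OF degree_smult_le])
  then show ?thesis using assms(2) by linarith
qed

lemma legendre_proj_add:
  assumes "continuous_on {0..1} g" "continuous_on {0..1} g'"
  shows "legendre_proj P s (\<lambda>x. g x + g' x) = legendre_proj P s g + legendre_proj P s g'"
proof -
  have "integral {0..1} (\<lambda>x. poly (P l) x * (g x + g' x))
      = integral {0..1} (\<lambda>x. poly (P l) x * g x) + integral {0..1} (\<lambda>x. poly (P l) x * g' x)" for l
    unfolding distrib_left
    by (intro integral_add integrable_continuous_interval continuous_intros assms)
  then show ?thesis
    by (simp add: legendre_proj_def smult_add_left sum.distrib)
qed

lemma legendre_proj_smult:
  "legendre_proj P s (\<lambda>x. a * g x) = smult a (legendre_proj P s g)"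
proof -
  have "integral {0..1} (\<lambda>x. poly (P l) x * (a * g x))
      = a * integral {0..1} (\<lambda>x. poly (P l) x * g x)" for l
    using integral_mult_right[of "{0..1}" a "\<lambda>x. poly (P l) x * g x"] by (simp add: mult_ac)
  moreover have "smult a (\<Sum>l\<in>A. g l) = (\<Sum>l\<in>A. smult a (g l))" for A and g :: "nat \<Rightarrow> real poly"
    by (induction A rule: infinite_finite_induct) (auto simp: smult_add_right)
  ultimately show ?thesis
    by (simp add: legendre_proj_def)
qed

lemma integral_legendre_times_proj:
  assumes P: "orthonormal_legendre P" and l: "l < s"
  shows "integral {0..1} (\<lambda>x. poly (P l) x * poly (legendre_proj P s g) x)
       = integral {0..1} (\<lambda>x. poly (P l) x * g x)"
proof -
  let ?a = "\<lambda>j. integral {0..1} (\<lambda>x. poly (P j) x * g x)"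
  have "integral {0..1} (\<lambda>x. poly (P l) x * poly (legendre_proj P s g) x)
      = integral {0..1} (\<lambda>x. \<Sum>j<s. ?a j *\<^sub>R (poly (P l) x * poly (P j) x))"
    by (simp add: legendre_proj_def poly_sum sum_distrib_left mult_ac)
  also have "\<dots> = (\<Sum>j<s. ?a j *\<^sub>R integral {0..1} (\<lambda>x. poly (P l) x * poly (P j) x))"
    by (subst integral_sum) (auto intro!: integrable_continuous_interval continuous_intros)
  also have "\<dots> = (\<Sum>j<s. if l = j then ?a j else 0)"
    by (intro sum.cong) (auto simp: orthonormal_legendre_integral[OF P])
  also have "\<dots> = ?a l" using l by simp
  finally show ?thesis .
qed

lemma legendre_proj_residual_orthogonal:
  assumes P: "orthonormal_legendre P" and q: "degree q < s"
    and g: "continuous_on {0..1} g"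
  shows "integral {0..1} (\<lambda>x. poly q x * (g x - poly (legendre_proj P s g) x)) = 0"
proof -
  obtain a where a: "q = (\<Sum>l<s. smult (a l) (P l))"
    using legendre_span[OF P q] by blast
  let ?r = "\<lambda>x. g x - poly (legendre_proj P s g) x"
  have 0: "integral {0..1} (\<lambda>x. poly (P l) x * ?r x) = 0" if "l < s" for l
  proof -
    have "integral {0..1} (\<lambda>x. poly (P l) x * ?r x)
        = integral {0..1} (\<lambda>x. poly (P l) x * g x)
        - integral {0..1} (\<lambda>x. poly (P l) x * poly (legendre_proj P s g) x)"
      unfolding right_diff_distrib
      by (intro integral_diff integrable_continuous_interval continuous_intros g)
    then show ?thesis using integral_legendre_times_proj[OF P that] by simp
  qed
  have "integral {0..1} (\<lambda>x. poly q x * ?r x)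
      = integral {0..1} (\<lambda>x. \<Sum>l<s. a l *\<^sub>R (poly (P l) x * ?r x))"
    by (simp add: a poly_sum sum_distrib_right mult.assoc)
  also have "\<dots> = (\<Sum>l<s. a l *\<^sub>R integral {0..1} (\<lambda>x. poly (P l) x * ?r x))"
    by (subst integral_sum) (auto intro!: integrable_continuous_interval continuous_intros g)
  also have "\<dots> = 0" using 0 by simp
  finally show ?thesis .
qed

text \<open>
  \<open>P 0\<close> is the constant \<open>1\<close> or \<open>-1\<close>, and every other \<open>P l\<close> is orthogonal to it.  This makes
  the weights of the update equal to those of the quadrature formula, whatever the sign of \<open>P 0\<close>.
\<close>

lemma integral_legendre_square_cancel:
  assumes P: "orthonormal_legendre P"
  shows "integral {0..1} (poly (P l)) * poly (P l) x = (if l = 0 then 1 else 0)"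
proof -
  obtain \<kappa> where \<kappa>: "P 0 = [:\<kappa>:]"
    using degree_legendre[OF P, of 0] by (metis degree_eq_zeroE)
  have *: "\<kappa> * integral {0..1} (poly (P l)) = (if l = 0 then 1 else 0)"
    using orthonormal_legendre_integral[OF P, of 0 l] by (auto simp: \<kappa>)
  show ?thesis
  proof (cases "l = 0")
    case True
    then show ?thesis using * by (simp add: \<kappa> mult.commute)
  next
    case False
    have "\<kappa> \<noteq> 0" using legendre_nonzero[OF P, of 0] \<kappa> by auto
    then show ?thesis using * False by simp
  qed
qed

text \<open>
  Divide \<open>p\<close> by \<open>P k\<close>.  The quotient has degree less than \<open>k\<close>, so its product with \<open>P k\<close>
  integrates to zero, and that product also vanishes at the nodes; the remainder is its own Lagrange
  interpolant, for which the formula holds by the choice of the weights.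
\<close>

lemma gauss_legendre_exact:
  assumes P: "orthonormal_legendre P" and G: "gauss_legendre P k c \<omega>"
    and p: "degree p < 2 * k"
  shows "integral {0..1} (poly p) = (\<Sum>i<k. \<omega> i * poly p (c i))"
proof -
  define L :: "nat \<Rightarrow> real poly" where
    "L i = (\<Prod>j\<in>{..<k} - {i}. smult (1 / (c i - c j)) [:- c j, 1:])" for i
  have k: "k > 0" using p by simp
  have inj: "inj_on c {..<k}"
    using G by (auto simp: gauss_legendre_def intro: strict_mono_on_imp_inj_on)
  have root: "poly (P k) (c i) = 0" if "i < k" for i
    using G that by (auto simp: gauss_legendre_def)
  have L: "poly (L i) x = (\<Prod>j\<in>{..<k} - {i}. (x - c j) / (c i - c j))" for i x
    by (simp add: L_def poly_prod add.commute diff_divide_distrib)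
  have w: "\<omega> i = integral {0..1} (poly (L i))" if "i < k" for i
  proof -
    have "poly (L i) = (\<lambda>x. \<Prod>j\<in>{..<k} - {i}. (x - c j) / (c i - c j))"
      by (rule ext) (rule L)
    then show ?thesis using G that by (simp add: gauss_legendre_def)
  qed
  have degL: "degree (L i) < k" if "i < k" for i
  proof -
    have "degree (L i) \<le> (\<Sum>j\<in>{..<k} - {i}. degree (smult (1 / (c i - c j)) [:- c j, 1:]))"
      unfolding L_def
      by (rule order_trans[OF degree_prod_sum_le]) (simp_all only: o_def finite_Diff finite_lessThan order_refl)
    also have "\<dots> \<le> (\<Sum>j\<in>{..<k} - {i}. 1)"
      by (intro sum_mono) simp
    finally show ?thesis using that by simp
  qed
  have Lc: "poly (L i) (c j) = (if i = j then 1 else 0)" if "i < k" "j < k" for i j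
  proof (cases "i = j")
    case True
    then show ?thesis
      using inj that by (auto simp: L inj_on_def intro!: prod.neutral split: if_splits)
  next
    case False
    then show ?thesis using that by (auto simp: L)
  qed
  define q r where "q = p div P k" and "r = p mod P k"
  have pqr: "p = q * P k + r" by (simp add: q_def r_def)
  have Pk: "P k \<noteq> 0" using legendre_nonzero[OF P] .
  have degr: "degree r < k"
    using degree_mod_less'[of "P k" p] Pk k degree_legendre[OF P, of k]
    by (cases "r = 0") (auto simp: r_def)
  have degq: "degree q < k"
  proof (cases "q = 0")
    case False
    have "degree (q * P k) = degree q + k"
      using degree_mult_eq[OF False Pk] degree_legendre[OF P, of k] by simp
    moreover have "degree (q * P k) < 2 * k"
    proof -
      have "q * P k = p - r" using pqr by simp
      then show ?thesis using degree_diff_less[of p "2*k" r] p degr by simp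
    qed
    ultimately show ?thesis by linarith
  qed (use k in simp)
  have interp: "r = (\<Sum>i<k. smult (poly r (c i)) (L i))"
  proof (rule ccontr)
    define d where "d = r - (\<Sum>i<k. smult (poly r (c i)) (L i))"
    assume "r \<noteq> (\<Sum>i<k. smult (poly r (c i)) (L i))"
    then have d0: "d \<noteq> 0" by (simp add: d_def)
    have "degree (\<Sum>i<k. smult (poly r (c i)) (L i)) < k"
      using degree_sum_less[of "{..<k}" "\<lambda>i. smult (poly r (c i)) (L i)" k] k degL
      by (force intro: le_less_trans[OF degree_smult_le])
    then have "degree d < k" unfolding d_def using degr by (intro degree_diff_less)
    moreover have "poly d (c j) = 0" if "j < k" for j
      using that
      by (simp add: d_def poly_sum Lc if_distrib[of "\<lambda>x. _ * x"] sum.delta' cong: if_cong)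
    then have "c ` {..<k} \<subseteq> {x. poly d x = 0}" by auto
    then have "card (c ` {..<k}) \<le> card {x. poly d x = 0}"
      using poly_roots_finite[OF d0] by (rule card_mono[rotated])
    then have "k \<le> degree d"
      using card_poly_roots_bound[OF d0] card_image[OF inj] by simp
    ultimately show False by simp
  qed
  have intr: "integral {0..1} (poly r) = (\<Sum>i<k. \<omega> i * poly r (c i))"
  proof -
    have "poly r = (\<lambda>x. \<Sum>i<k. poly r (c i) *\<^sub>R poly (L i) x)"
      by (subst interp) (auto simp: poly_sum)
    then have "integral {0..1} (poly r) = integral {0..1} (\<lambda>x. \<Sum>i<k. poly r (c i) *\<^sub>R poly (L i) x)"
      by simp
    also have "\<dots> = (\<Sum>i<k. poly r (c i) *\<^sub>R integral {0..1} (poly (L i)))"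
      by (subst integral_sum) (auto intro!: integrable_continuous_interval continuous_intros)
    also have "\<dots> = (\<Sum>i<k. \<omega> i * poly r (c i))"
      by (intro sum.cong) (auto simp: w)
    finally show ?thesis .
  qed
  have "integral {0..1} (poly p) = integral {0..1} (\<lambda>x. poly q x * poly (P k) x + poly r x)"
    by (intro arg_cong[where f = "integral {0..1}"] ext) (subst pqr, simp)
  also have "\<dots> = integral {0..1} (\<lambda>x. poly q x * poly (P k) x) + integral {0..1} (poly r)"
    by (intro integral_add integrable_continuous_interval continuous_intros)
  also have "\<dots> = (\<Sum>i<k. \<omega> i * poly r (c i))"
    by (simp add: legendre_orthogonal_lower_degree[OF P degq] intr)
  also have "\<dots> = (\<Sum>i<k. \<omega> i * poly p (c i))"
    by (intro sum.cong) (auto simp: pqr root)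
  finally show ?thesis .
qed

section \<open>Polynomial functions of bounded degree\<close>

text \<open>
  \<open>polyfun d g\<close>: the real function \<open>g\<close> is polynomial of degree at most \<open>d\<close> in the coordinates.  The
  predicate \<^const>\<open>real_polynomial_function\<close> carries no degree, and the degree is what decides whether
  a quadrature formula is exact along a polynomial curve.
\<close>

inductive polyfun :: "nat \<Rightarrow> ('a::euclidean_space \<Rightarrow> real) \<Rightarrow> bool" where
  const: "polyfun d (\<lambda>x. a)"
| linear: "bounded_linear f \<Longrightarrow> polyfun (Suc d) f"
| add: "polyfun d f \<Longrightarrow> polyfun d g \<Longrightarrow> polyfun d (\<lambda>x. f x + g x)"
| mult: "polyfun d f \<Longrightarrow> polyfun e g \<Longrightarrow> polyfun (d + e) (\<lambda>x. f x * g x)"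

lemma polyfun_mono: "polyfun d f \<Longrightarrow> d \<le> e \<Longrightarrow> polyfun e f"
  using polyfun.mult[of d f "e - d" "\<lambda>_. 1", OF _ polyfun.const] by simp

lemma polyfun_cmult: "polyfun d f \<Longrightarrow> polyfun d (\<lambda>x. a * f x)"
  using polyfun.mult[of 0 "\<lambda>_. a" d f, OF polyfun.const] by simp

lemma polyfun_diff: "polyfun d f \<Longrightarrow> polyfun d g \<Longrightarrow> polyfun d (\<lambda>x. f x - g x)"
  using polyfun.add[of d f "\<lambda>x. (-1) * g x", OF _ polyfun_cmult] by simp

lemma polyfun_sum:
  "(\<And>i. i \<in> S \<Longrightarrow> polyfun d (f i)) \<Longrightarrow> polyfun d (\<lambda>x. \<Sum>i\<in>S. f i x)"
proof (induction S rule: infinite_finite_induct)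
  case (insert i S)
  then show ?case by (simp add: polyfun.add)
qed (simp_all add: polyfun.const)

lemma linear_functional_expansion:
  fixes f :: "'a::euclidean_space \<Rightarrow> real"
  assumes "bounded_linear f"
  shows "f z = (\<Sum>b\<in>Basis. (z \<bullet> b) * f b)"
proof -
  interpret bounded_linear f by fact
  have "f z = f (\<Sum>b\<in>Basis. (z \<bullet> b) *\<^sub>R b)" by (simp add: euclidean_representation)
  also have "\<dots> = (\<Sum>b\<in>Basis. (z \<bullet> b) * f b)" by (simp add: sum scale)
  finally show ?thesis .
qed

lemma polyfun_real_polynomial_function: "polyfun d g \<Longrightarrow> real_polynomial_function g"
  by (induction rule: polyfun.induct) auto

lemma polyfun_continuous: "polyfun d g \<Longrightarrow> continuous_on A g"
  using continuous_on_polymonial_function[of g A] polyfun_real_polynomial_function[of d g]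
  by (simp add: real_polynomial_function_eq)

lemma polyfun_along_polynomial_curve:
  assumes "polyfun d g"
    and u: "\<And>b. b \<in> Basis \<Longrightarrow> \<exists>p. degree p \<le> n \<and> (\<forall>t::real. u t \<bullet> b = poly p t)"
  shows "\<exists>p. degree p \<le> d * n \<and> (\<forall>t. g (u t) = poly p t)"
  using assms(1)
proof (induction rule: polyfun.induct)
  case (const d a)
  show ?case by (intro exI[of _ "[:a:]"]) auto
next
  case (linear f d)
  obtain p where p: "\<And>b. b \<in> Basis \<Longrightarrow> degree (p b) \<le> n \<and> (\<forall>t. u t \<bullet> b = poly (p b) t)"
    using u by metis
  define q where "q = (\<Sum>b\<in>Basis. smult (f b) (p b))"
  have "degree q \<le> n"
    unfolding q_def
    by (intro degree_sum_le) (auto intro: order_trans[OF degree_smult_le] simp: p)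
  moreover have "f (u t) = poly q t" for t
    using linear_functional_expansion[OF linear(1), of "u t"] p
    by (simp add: q_def poly_sum mult.commute)
  ultimately show ?case by (intro exI[of _ q]) auto
next
  case (add d f g)
  then obtain p q where "degree p \<le> d * n" "\<forall>t. f (u t) = poly p t"
    "degree q \<le> d * n" "\<forall>t. g (u t) = poly q t"
    by blast
  then show ?case by (intro exI[of _ "p + q"]) (auto intro: degree_add_le)
next
  case (mult d f e g)
  then obtain p q where "degree p \<le> d * n" "\<forall>t. f (u t) = poly p t"
    "degree q \<le> e * n" "\<forall>t. g (u t) = poly q t"
    by blast
  then show ?case
    by (intro exI[of _ "p * q"])
       (auto intro!: order_trans[OF degree_mult_le] simp: algebra_simps add_mono)
qed

lemma real_polynomial_function_fst_snd:
  assumes "polyfun d g"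
  shows "real_polynomial_function (\<lambda>z. g (fst z))" "real_polynomial_function (\<lambda>z. g (snd z))"
  using real_polynomial_function_compose[OF polynomial_function_bounded_linear[OF bounded_linear_fst]
      polyfun_real_polynomial_function[OF assms]]
    real_polynomial_function_compose[OF polynomial_function_bounded_linear[OF bounded_linear_snd]
      polyfun_real_polynomial_function[OF assms]]
  by (simp_all add: o_def)

text \<open>
  The mean value theorem for polynomials: the increment is linear in \<open>u - v\<close>, with coefficients that
  are again polynomial in \<open>(u, v)\<close>.  Thus the difference of two solutions of a nonlinear polynomial
  equation solves a linear equation whose coefficients are as smooth as the two solutions.
\<close>

lemma polyfun_increment:
  fixes g :: "'a::euclidean_space \<Rightarrow> real"
  assumes "polyfun d g"
  shows "\<exists>A :: 'a \<Rightarrow> 'a \<times> 'a \<Rightarrow> real. (\<forall>b. real_polynomial_function (A b)) \<and>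
           (\<forall>u v. g u - g v = (\<Sum>b\<in>Basis. A b (u, v) * ((u - v) \<bullet> b)))"
  using assms
proof (induction rule: polyfun.induct)
  case (const d a)
  show ?case by (intro exI[of _ "\<lambda>_ _. 0"]) auto
next
  case (linear f d)
  show ?case
  proof (intro exI[of _ "\<lambda>b _. f b"] conjI allI)
    interpret bounded_linear f by fact
    show "f u - f v = (\<Sum>b\<in>Basis. f b * ((u - v) \<bullet> b))" for u v
      using linear_functional_expansion[OF \<open>bounded_linear f\<close>, of "u - v"] by (simp add: diff mult.commute)
  qed auto
next
  case (add d f g)
  then obtain A B where A: "\<forall>b. real_polynomial_function (A b)"
    "\<forall>u v. f u - f v = (\<Sum>b\<in>Basis. A b (u, v) * ((u - v) \<bullet> b))"
    and B: "\<forall>b. real_polynomial_function (B b)"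
    "\<forall>u v. g u - g v = (\<Sum>b\<in>Basis. B b (u, v) * ((u - v) \<bullet> b))"
    by blast
  show ?case
  proof (intro exI[of _ "\<lambda>b z. A b z + B b z"] conjI allI)
    show "f u + g u - (f v + g v) = (\<Sum>b\<in>Basis. (A b (u, v) + B b (u, v)) * ((u - v) \<bullet> b))" for u v
      using A(2)[rule_format, of u v] B(2)[rule_format, of u v]
      by (simp add: algebra_simps sum.distrib del: inner_diff_left)
  qed (use A B in auto)
next
  case (mult d f e g)
  then obtain A B where A: "\<forall>b. real_polynomial_function (A b)"
    "\<forall>u v. f u - f v = (\<Sum>b\<in>Basis. A b (u, v) * ((u - v) \<bullet> b))"
    and B: "\<forall>b. real_polynomial_function (B b)"
    "\<forall>u v. g u - g v = (\<Sum>b\<in>Basis. B b (u, v) * ((u - v) \<bullet> b))"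
    by blast
  show ?case
  proof (intro exI[of _ "\<lambda>b z. A b z * g (fst z) + f (snd z) * B b z"] conjI allI)
    show "f u * g u - f v * g v
        = (\<Sum>b\<in>Basis. (A b (u, v) * g (fst (u, v)) + f (snd (u, v)) * B b (u, v)) * ((u - v) \<bullet> b))" for u v
    proof -
      have "f u * g u - f v * g v = (f u - f v) * g u + f v * (g u - g v)"
        by (simp add: algebra_simps)
      also have "\<dots> = (\<Sum>b\<in>Basis. A b (u, v) * ((u - v) \<bullet> b) * g u)
          + (\<Sum>b\<in>Basis. f v * (B b (u, v) * ((u - v) \<bullet> b)))"
        unfolding A(2)[rule_format, of u v] B(2)[rule_format, of u v]
        by (simp only: sum_distrib_left sum_distrib_right)
      also have "\<dots> = (\<Sum>b\<in>Basis. (A b (u, v) * g (fst (u, v)) + f (snd (u, v)) * B b (u, v)) * ((u - v) \<bullet> b))"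
        unfolding sum.distrib[symmetric] by (intro sum.cong) (auto simp: algebra_simps)
      finally show ?thesis .
    qed
    show "real_polynomial_function (\<lambda>z. A b z * g (fst z) + f (snd z) * B b z)" for b
      by (intro real_polynomial_function.intros(3,4)
            A(1)[rule_format] B(1)[rule_format]
            real_polynomial_function_fst_snd(1)[OF mult.hyps(2)]
            real_polynomial_function_fst_snd(2)[OF mult.hyps(1)])
  qed
qed

section \<open>The polynomial curve through the stages\<close>

text \<open>
  The quadrature value of the \<open>l\<close>-th Legendre coefficient of \<open>f\<close> along the curve through the stages.
\<close>

definition legendre_coeff ::
  "(nat \<Rightarrow> real poly) \<Rightarrow> (nat \<Rightarrow> real) \<Rightarrow> (nat \<Rightarrow> real) \<Rightarrow> nat \<Rightarrow> ('v::real_vector \<Rightarrow> 'v) \<Rightarrow> (nat \<Rightarrow> 'v) \<Rightarrow>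
   nat \<Rightarrow> 'v" where
  "legendre_coeff P c \<omega> k f Y l = (\<Sum>j<k. (\<omega> j * poly (P l) (c j)) *\<^sub>R f (Y j))"

text \<open>
  The continuous extension of a step, in the rescaled time that runs from \<open>0\<close> to \<open>1\<close>.  Its derivative
  is \<open>h\<close> times the polynomial of degree less than \<open>s\<close> whose Legendre coefficients are the values
  \<^const>\<open>legendre_coeff\<close>.
\<close>

definition hbvm_curve ::
  "(nat \<Rightarrow> real poly) \<Rightarrow> (nat \<Rightarrow> real) \<Rightarrow> (nat \<Rightarrow> real) \<Rightarrow> nat \<Rightarrow> nat \<Rightarrow> ('v::real_vector \<Rightarrow> 'v) \<Rightarrow>
   real \<Rightarrow> 'v \<Rightarrow> (nat \<Rightarrow> 'v) \<Rightarrow> real \<Rightarrow> 'v" where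
  "hbvm_curve P c \<omega> s k f h y0 Y t =
     y0 + h *\<^sub>R (\<Sum>l<s. poly (antideriv (P l)) t *\<^sub>R legendre_coeff P c \<omega> k f Y l)"

lemma hbvm_curve_0 [simp]: "hbvm_curve P c \<omega> s k f h y0 Y 0 = y0"
  by (simp add: hbvm_curve_def)

lemma hbvm_curve_node:
  assumes "rk_stages k (hbvm_matrix P c \<omega> s) f h y0 Y" "i < k" "0 \<le> c i"
  shows "hbvm_curve P c \<omega> s k f h y0 Y (c i) = Y i"
proof -
  have "(\<Sum>l<s. poly (antideriv (P l)) (c i) *\<^sub>R legendre_coeff P c \<omega> k f Y l)
      = (\<Sum>l<s. \<Sum>j<k. (integral {0..c i} (poly (P l)) * poly (P l) (c j) * \<omega> j) *\<^sub>R f (Y j))"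
    by (intro sum.cong)
       (auto simp: legendre_coeff_def scaleR_sum_right integral_poly_from_0[OF assms(3)] mult_ac)
  also have "\<dots> = (\<Sum>j<k. hbvm_matrix P c \<omega> s i j *\<^sub>R f (Y j))"
    unfolding hbvm_matrix_def scaleR_sum_left by (rule sum.swap)
  finally show ?thesis
    using assms by (simp add: hbvm_curve_def rk_stages_def)
qed

lemma hbvm_curve_1:
  assumes P: "orthonormal_legendre P" and "s \<ge> 1"
  shows "hbvm_curve P c \<omega> s k f h y0 Y 1 = rk_update k \<omega> f h y0 Y"
proof -
  have "(\<Sum>l<s. poly (antideriv (P l)) 1 *\<^sub>R legendre_coeff P c \<omega> k f Y l)
      = (\<Sum>l<s. \<Sum>j<k. (if l = 0 then \<omega> j else 0) *\<^sub>R f (Y j))"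
  proof (intro sum.cong refl)
    fix l
    have "poly (antideriv (P l)) 1 * (\<omega> j * poly (P l) (c j)) = (if l = 0 then \<omega> j else 0)" for j
      using integral_legendre_square_cancel[OF P, of l "c j"] integral_poly_from_0[of 1 "P l"]
      by (auto simp: mult_ac)
    then show "poly (antideriv (P l)) 1 *\<^sub>R legendre_coeff P c \<omega> k f Y l
        = (\<Sum>j<k. (if l = 0 then \<omega> j else 0) *\<^sub>R f (Y j))"
      by (simp add: legendre_coeff_def scaleR_sum_right)
  qed
  also have "\<dots> = (\<Sum>l<s. if l = 0 then (\<Sum>j<k. \<omega> j *\<^sub>R f (Y j)) else 0)"
    by (intro sum.cong) auto
  also have "\<dots> = (\<Sum>j<k. \<omega> j *\<^sub>R f (Y j))"
    using assms(2) by (simp add: sum.delta)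
  finally show ?thesis by (simp add: hbvm_curve_def rk_update_def)
qed

lemma hbvm_curve_has_vector_derivative:
  fixes f :: "'v::real_normed_vector \<Rightarrow> 'v"
  shows "(hbvm_curve P c \<omega> s k f h y0 Y has_vector_derivative
    h *\<^sub>R (\<Sum>l<s. poly (P l) t *\<^sub>R legendre_coeff P c \<omega> k f Y l)) (at t within S)"
proof -
  have "((\<lambda>t. poly (antideriv (P l)) t *\<^sub>R legendre_coeff P c \<omega> k f Y l) has_vector_derivative
      poly (P l) t *\<^sub>R legendre_coeff P c \<omega> k f Y l) (at t within S)" for l
    using has_vector_derivative_scaleR[of "poly (antideriv (P l))" "poly (P l) t" t S
        "\<lambda>_. legendre_coeff P c \<omega> k f Y l" 0]
      DERIV_subset[OF poly_DERIV[of "antideriv (P l)" t]]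
    by simp
  then show ?thesis
    unfolding hbvm_curve_def by (auto intro!: derivative_eq_intros)
qed

lemma hbvm_curve_polynomial:
  fixes f :: "'v::euclidean_space \<Rightarrow> 'v"
  assumes "orthonormal_legendre P"
  shows "\<exists>p. degree p \<le> s \<and> (\<forall>t. hbvm_curve P c \<omega> s k f h y0 Y t \<bullet> b = poly p t)"
proof (intro exI conjI allI)
  define p where "p = [:y0 \<bullet> b:] + smult h (\<Sum>l<s. smult (legendre_coeff P c \<omega> k f Y l \<bullet> b) (antideriv (P l)))"
  show "degree p \<le> s"
    unfolding p_def
    by (intro degree_add_le order_trans[OF degree_smult_le] degree_sum_le)
       (auto intro!: order_trans[OF degree_smult_le] order_trans[OF degree_antideriv]
             simp: degree_legendre[OF assms])
  show "hbvm_curve P c \<omega> s k f h y0 Y t \<bullet> b = poly p t" for t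
    by (simp add: p_def hbvm_curve_def inner_add_left inner_sum_left poly_sum mult.commute)
qed

text \<open>
  Let \<open>u\<close> be the curve of the step.  Then \<open>H \<circ> u\<close> is a polynomial of degree at most \<open>\<nu> s \<le> 2 k\<close>, so
  the quadrature formula integrates its derivative exactly.  The derivative is \<open>\<nabla>H(u) \<bullet> u'\<close>, and \<open>u'\<close>
  is a combination of the \<open>P l\<close> with coefficients \<open>h J \<gamma>\<^sub>l\<close>, where \<open>\<gamma>\<^sub>l\<close> is the quadrature value of the
  \<open>l\<close>-th Legendre coefficient of \<open>\<nabla>H(u)\<close>.  The quadrature sum is therefore \<open>h \<Sum>\<^sub>l \<gamma>\<^sub>l \<bullet> J \<gamma>\<^sub>l\<close>, and
  every term of it vanishes because \<open>J\<close> is skew.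
\<close>

lemma hbvm_energy_conserving:
  fixes H :: "'v::euclidean_space \<Rightarrow> real"
  assumes P: "orthonormal_legendre P" and G: "gauss_legendre P k c \<omega>"
    and s: "s \<ge> 1" and k: "k \<ge> 1"
    and H: "polyfun \<nu> H" and deg: "\<nu> * s \<le> 2 * k"
    and grad: "\<And>z. GDERIV H z :> g z"
    and lin: "linear J" and skew: "\<And>z. z \<bullet> J z = 0"
  shows "energy_conserving k (hbvm_matrix P c \<omega> s) \<omega> (\<lambda>z. J (g z)) H"
  unfolding energy_conserving_def
proof (intro allI impI)
  fix h :: real and y0 Y
  let ?f = "\<lambda>z. J (g z)"
  assume st: "rk_stages k (hbvm_matrix P c \<omega> s) ?f h y0 Y"
  define u where "u = hbvm_curve P c \<omega> s k ?f h y0 Y"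
  define \<gamma> where "\<gamma> l = (\<Sum>j<k. (\<omega> j * poly (P l) (c j)) *\<^sub>R g (Y j))" for l
  have coeff: "legendre_coeff P c \<omega> k ?f Y l = J (\<gamma> l)" for l
    by (simp add: legendre_coeff_def \<gamma>_def linear_sum[OF lin] linear_scale[OF lin])
  obtain p where p: "degree p \<le> \<nu> * s" "\<And>t. H (u t) = poly p t"
    using polyfun_along_polynomial_curve[OF H hbvm_curve_polynomial[OF P]] unfolding u_def by blast
  have der: "poly (pderiv p) t = h * (\<Sum>l<s. poly (P l) t * (J (\<gamma> l) \<bullet> g (u t)))" for t
  proof (rule DERIV_unique)
    show "((\<lambda>t. H (u t)) has_real_derivative poly (pderiv p) t) (at t)"
      unfolding p(2) by (rule poly_DERIV)
    have "(u has_vector_derivative h *\<^sub>R (\<Sum>l<s. poly (P l) t *\<^sub>R J (\<gamma> l))) (at t)"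
      using hbvm_curve_has_vector_derivative[of P c \<omega> s k ?f h y0 Y t UNIV]
      by (simp add: u_def coeff)
    then have "((\<lambda>t. H (u t)) has_derivative
        (\<lambda>x. (x *\<^sub>R (h *\<^sub>R (\<Sum>l<s. poly (P l) t *\<^sub>R J (\<gamma> l)))) \<bullet> g (u t))) (at t)"
      using has_derivative_compose[of u _ t UNIV H] grad[of "u t"]
      unfolding has_vector_derivative_def gderiv_def by blast
    then show "((\<lambda>t. H (u t)) has_real_derivative h * (\<Sum>l<s. poly (P l) t * (J (\<gamma> l) \<bullet> g (u t)))) (at t)"
      by (rule has_derivative_imp_has_field_derivative)
         (simp add: inner_sum_left mult_ac sum_distrib_left)
  qed
  have node: "u (c i) = Y i" if "i < k" for i
    using G hbvm_curve_node[OF st that] that by (auto simp: u_def gauss_legendre_def)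
  have "degree (pderiv p) < 2 * k"
    using p(1) deg k by (auto simp: degree_pderiv)
  then have "integral {0..1} (poly (pderiv p)) = (\<Sum>i<k. \<omega> i * poly (pderiv p) (c i))"
    by (rule gauss_legendre_exact[OF P G])
  also have "\<dots> = (\<Sum>i<k. \<Sum>l<s. h * (J (\<gamma> l) \<bullet> ((\<omega> i * poly (P l) (c i)) *\<^sub>R g (Y i))))"
    by (intro sum.cong) (auto simp: der node sum_distrib_left mult_ac)
  also have "\<dots> = (\<Sum>l<s. h * (J (\<gamma> l) \<bullet> \<gamma> l))"
    by (subst sum.swap) (simp add: \<gamma>_def inner_sum_right sum_distrib_left)
  also have "\<dots> = 0"
    by (simp add: inner_commute skew)
  finally have "integral {0..1} (poly (pderiv p)) = 0" .
  moreover have "(poly (pderiv p) has_integral poly p 1 - poly p 0) {0..1}"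
    by (rule fundamental_theorem_of_calculus)
       (auto simp: has_real_derivative_iff_has_vector_derivative[symmetric]
             intro!: derivative_eq_intros)
  ultimately have "poly p 1 = poly p 0" by (simp add: integral_unique)
  then show "H (rk_update k \<omega> ?f h y0 Y) = H y0"
    using hbvm_curve_1[OF P s, of c \<omega> k ?f h y0 Y] p(2)[of 0] p(2)[of 1]
    by (simp add: u_def)
qed

section \<open>Asymptotic expansions that are uniform in a family of steps\<close>

text \<open>
  Integration by parts with the primitive of \<open>\<psi>\<close> that vanishes at \<open>1\<close> and the primitive of \<open>g\<close> that
  vanishes at \<open>0\<close>, so that there are no boundary terms.
\<close>

lemma integral_by_parts_primitives:
  fixes \<psi> g :: "real \<Rightarrow> real"
  assumes \<psi>: "continuous_on {0..1} \<psi>" and g: "continuous_on {0..1} g"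
  shows "integral {0..1} (\<lambda>t. \<psi> t * integral {0..t} g)
       = integral {0..1} (\<lambda>t. (integral {0..1} \<psi> - integral {0..t} \<psi>) * g t)"
proof -
  let ?\<Psi> = "\<lambda>t. integral {0..1} \<psi> - integral {0..t} \<psi>" and ?G = "\<lambda>t. integral {0..t} g"
  have c: "continuous_on {0..1} (\<lambda>t. integral {0..t} \<psi>)" "continuous_on {0..1} ?G"
    using \<psi> g by (auto intro!: indefinite_integral_continuous_1 integrable_continuous_interval)
  have d: "((\<lambda>t. integral {0..t} \<phi>) has_real_derivative \<phi> t) (at t within {0..1})"
    if "continuous_on {0..1} \<phi>" "t \<in> {0..1}" for \<phi> :: "real \<Rightarrow> real" and t
    using integral_has_real_derivative[OF that] .
  have "((\<lambda>t. ?\<Psi> t * g t - \<psi> t * ?G t) has_integral ?\<Psi> 1 * ?G 1 - ?\<Psi> 0 * ?G 0) {0..1}"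
  proof (rule fundamental_theorem_of_calculus)
    fix t :: real assume t: "t \<in> {0..1}"
    have "((\<lambda>t. ?\<Psi> t * ?G t) has_real_derivative ?\<Psi> t * g t - \<psi> t * ?G t) (at t within {0..1})"
      by (rule DERIV_cong, rule DERIV_mult[OF DERIV_diff[OF DERIV_const d[OF \<psi> t]] d[OF g t]])
         (simp add: algebra_simps)
    then show "((\<lambda>t. ?\<Psi> t * ?G t) has_vector_derivative ?\<Psi> t * g t - \<psi> t * ?G t)
        (at t within {0..1})"
      by (simp add: has_real_derivative_iff_has_vector_derivative)
  qed simp
  then have "integral {0..1} (\<lambda>t. ?\<Psi> t * g t - \<psi> t * ?G t) = 0"
    by (simp add: integral_unique)
  moreover have "integral {0..1} (\<lambda>t. ?\<Psi> t * g t - \<psi> t * ?G t)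
      = integral {0..1} (\<lambda>t. ?\<Psi> t * g t) - integral {0..1} (\<lambda>t. \<psi> t * ?G t)"
    by (intro integral_diff integrable_continuous_interval continuous_intros \<psi> g c)
  ultimately show ?thesis by simp
qed

text \<open>
  The estimates for the order must hold with one constant for all small stepsizes and all choices of
  the stages.  Hence functions of the rescaled time \<open>t \<in> [0,1]\<close> are considered in families with an
  index \<open>p\<close>, which stands for a step; \<open>h p\<close> is its stepsize.  The bound \<open>h p \<le> 1\<close> makes
  \<open>O(h\<^sup>n)\<close> stronger than \<open>O(h\<^sup>m)\<close> for \<open>m \<le> n\<close>.
\<close>

locale step_family =
  fixes I :: "'p set" and h :: "'p \<Rightarrow> real"
  assumes h: "p \<in> I \<Longrightarrow> 0 < h p \<and> h p \<le> 1"
begin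

definition unif_O :: "nat \<Rightarrow> ('p \<Rightarrow> real \<Rightarrow> real) \<Rightarrow> bool" where
  "unif_O m G \<longleftrightarrow> (\<exists>C. \<forall>p\<in>I. \<forall>t\<in>{0..1}. \<bar>G p t\<bar> \<le> C * h p ^ m)"

lemma unif_OI: "(\<And>p t. p \<in> I \<Longrightarrow> 0 \<le> t \<Longrightarrow> t \<le> 1 \<Longrightarrow> \<bar>G p t\<bar> \<le> C * h p ^ m) \<Longrightarrow> unif_O m G"
  unfolding unif_O_def by (intro exI[of _ C]) auto

lemma unif_O_nonneg_bound:
  assumes "unif_O m G"
  shows "\<exists>C\<ge>0. \<forall>p\<in>I. \<forall>t\<in>{0..1}. \<bar>G p t\<bar> \<le> C * h p ^ m"
proof -
  obtain C where C: "\<forall>p\<in>I. \<forall>t\<in>{0..1}. \<bar>G p t\<bar> \<le> C * h p ^ m"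
    using assms by (auto simp: unif_O_def)
  have "C * h p ^ m \<le> max C 0 * h p ^ m" if "p \<in> I" for p
    using h[OF that] by (intro mult_right_mono) auto
  with C show ?thesis by (intro exI[of _ "max C 0"]) (auto intro: order_trans)
qed

lemma unif_O_cong:
  assumes "unif_O m G" "\<And>p t. p \<in> I \<Longrightarrow> 0 \<le> t \<Longrightarrow> t \<le> 1 \<Longrightarrow> F p t = G p t"
  shows "unif_O m F"
  using assms by (auto simp: unif_O_def)

lemma unif_O_add:
  assumes "unif_O m F" "unif_O m G"
  shows "unif_O m (\<lambda>p t. F p t + G p t)"
proof -
  obtain C where C: "C \<ge> 0" "\<forall>p\<in>I. \<forall>t\<in>{0..1}. \<bar>F p t\<bar> \<le> C * h p ^ m"
    using unif_O_nonneg_bound[OF assms(1)] by blast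
  obtain D where D: "D \<ge> 0" "\<forall>p\<in>I. \<forall>t\<in>{0..1}. \<bar>G p t\<bar> \<le> D * h p ^ m"
    using unif_O_nonneg_bound[OF assms(2)] by blast
  show ?thesis
  proof (rule unif_OI[of _ "C + D"])
    fix p t assume p: "p \<in> I" "0 \<le> t" "t \<le> (1::real)"
    then have t: "t \<in> {0..1}" by simp
    show "\<bar>F p t + G p t\<bar> \<le> (C + D) * h p ^ m"
      unfolding distrib_right using C(2)[rule_format, OF p(1) t] D(2)[rule_format, OF p(1) t] by linarith
  qed
qed

lemma unif_O_mult:
  assumes "unif_O m F" "unif_O n G"
  shows "unif_O (m + n) (\<lambda>p t. F p t * G p t)"
proof -
  obtain C where C: "C \<ge> 0" "\<forall>p\<in>I. \<forall>t\<in>{0..1}. \<bar>F p t\<bar> \<le> C * h p ^ m"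
    using unif_O_nonneg_bound[OF assms(1)] by blast
  obtain D where D: "D \<ge> 0" "\<forall>p\<in>I. \<forall>t\<in>{0..1}. \<bar>G p t\<bar> \<le> D * h p ^ n"
    using unif_O_nonneg_bound[OF assms(2)] by blast
  show ?thesis
  proof (rule unif_OI[of _ "C * D"])
    fix p t assume p: "p \<in> I" "0 \<le> t" "t \<le> (1::real)"
    then have t: "t \<in> {0..1}" by simp
    have "0 \<le> C * h p ^ m" using C(1) h[OF p(1)] by simp
    then have "\<bar>F p t\<bar> * \<bar>G p t\<bar> \<le> (C * h p ^ m) * (D * h p ^ n)"
      by (intro mult_mono C(2)[rule_format, OF p(1) t] D(2)[rule_format, OF p(1) t] abs_ge_zero)
    also have "\<dots> = (C * D) * h p ^ (m + n)"
      unfolding power_add by (simp only: mult_ac)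
    finally show "\<bar>F p t * G p t\<bar> \<le> (C * D) * h p ^ (m + n)"
      by (simp only: abs_mult)
  qed
qed

lemma unif_O_le: "unif_O n G \<Longrightarrow> m \<le> n \<Longrightarrow> unif_O m G"
proof -
  assume G: "unif_O n G" and le: "m \<le> n"
  obtain C where C: "C \<ge> 0" "\<forall>p\<in>I. \<forall>t\<in>{0..1}. \<bar>G p t\<bar> \<le> C * h p ^ n"
    using unif_O_nonneg_bound[OF G] by blast
  show ?thesis
  proof (rule unif_OI[of _ C])
    fix p t assume p: "p \<in> I" "0 \<le> t" "t \<le> (1::real)"
    then have t: "t \<in> {0..1}" by simp
    have "h p ^ n \<le> h p ^ m" using h[OF p(1)] le by (intro power_decreasing) auto
    then have "C * h p ^ n \<le> C * h p ^ m" using C(1) by (rule mult_left_mono)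
    then show "\<bar>G p t\<bar> \<le> C * h p ^ m" using C(2)[rule_format, OF p(1) t] by linarith
  qed
qed

lemma unif_O_indep:
  assumes "continuous_on {0..1} g"
  shows "unif_O 0 (\<lambda>p t. g t)"
proof -
  have "bounded (g ` {0..1})"
    by (intro compact_imp_bounded compact_continuous_image assms) simp
  then obtain B where "\<forall>t\<in>{0..1}. \<bar>g t\<bar> \<le> B" by (auto simp: bounded_iff)
  then show ?thesis by (intro unif_OI[of _ B]) auto
qed

lemma unif_O_h: "unif_O k (\<lambda>p t. h p ^ k)"
  by (intro unif_OI[of _ 1]) (use h in \<open>simp add: less_imp_le\<close>)

lemma unif_O_zero: "unif_O m (\<lambda>p t. 0)"
  by (intro unif_OI[of _ 0]) auto

lemma unif_O_cmult: "unif_O m G \<Longrightarrow> unif_O m (\<lambda>p t. a * G p t)"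
  using unif_O_mult[OF unif_O_indep[of "\<lambda>_. a"], of m G] by simp

lemma unif_O_diff: "unif_O m F \<Longrightarrow> unif_O m G \<Longrightarrow> unif_O m (\<lambda>p t. F p t - G p t)"
  using unif_O_add[of m F "\<lambda>p t. (-1) * G p t"] unif_O_cmult[of m G "-1"] by simp

lemma unif_O_sum: "(\<And>i. i \<in> S \<Longrightarrow> unif_O m (G i)) \<Longrightarrow> unif_O m (\<lambda>p t. \<Sum>i\<in>S. G i p t)"
  by (induction S rule: infinite_finite_induct) (simp_all add: unif_O_zero unif_O_add)

lemma unif_O_integral:
  assumes "unif_O m G" and cont: "\<And>p. p \<in> I \<Longrightarrow> continuous_on {0..1} (G p)"
  shows "unif_O m (\<lambda>p t. integral {0..t} (G p))"
proof -
  obtain C where C: "C \<ge> 0" "\<forall>p\<in>I. \<forall>t\<in>{0..1}. \<bar>G p t\<bar> \<le> C * h p ^ m"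
    using unif_O_nonneg_bound[OF assms(1)] by blast
  show ?thesis
  proof (rule unif_OI[of _ C])
    fix p t assume p: "p \<in> I" "0 \<le> t" "t \<le> (1::real)"
    then have t: "t \<in> {0..1}" by simp
    have "norm (integral {0..t} (G p)) \<le> (C * h p ^ m) * (t - 0)"
    proof (rule integral_bound)
      show "continuous_on {0..t} (G p)"
        using p by (intro continuous_on_subset[OF cont]) auto
      show "norm (G p x) \<le> C * h p ^ m" if "x \<in> {0..t}" for x
        using C(2) p that by simp
    qed (use p in simp)
    also have "\<dots> \<le> (C * h p ^ m) * 1"
      using p(3) C(1) h[OF p(1)] by (intro mult_left_mono) auto
    finally show "\<bar>integral {0..t} (G p)\<bar> \<le> C * h p ^ m" by simp
  qed
qed

lemma unif_O_at_1: "unif_O m G \<Longrightarrow> unif_O m (\<lambda>p t. G p 1)"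
  unfolding unif_O_def by (meson atLeastAtMost_iff order_refl zero_le_one)

lemma unif_O_integral_1:
  "unif_O m G \<Longrightarrow> (\<And>p. p \<in> I \<Longrightarrow> continuous_on {0..1} (G p)) \<Longrightarrow>
    unif_O m (\<lambda>p t. integral {0..1} (G p))"
  using unif_O_at_1[OF unif_O_integral] .

lemma unif_O_legendre_proj:
  assumes "unif_O m G" "\<And>p. p \<in> I \<Longrightarrow> continuous_on {0..1} (G p)"
  shows "unif_O m (\<lambda>p t. poly (legendre_proj P s (G p)) t)"
proof -
  have "unif_O m (\<lambda>p t. \<Sum>l<s. poly (P l) t * integral {0..1} (\<lambda>x. poly (P l) x * G p x))"
  proof (intro unif_O_sum)
    fix l
    have "unif_O (0 + m) (\<lambda>p x. poly (P l) x * G p x)"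
      by (intro unif_O_mult unif_O_indep assms continuous_intros)
    then have "unif_O m (\<lambda>p t. integral {0..1} (\<lambda>x. poly (P l) x * G p x))"
      by (intro unif_O_integral_1 continuous_intros assms) simp
    then have "unif_O (0 + m) (\<lambda>p t. poly (P l) t * integral {0..1} (\<lambda>x. poly (P l) x * G p x))"
      by (intro unif_O_mult unif_O_indep continuous_intros)
    then show "unif_O m (\<lambda>p t. poly (P l) t * integral {0..1} (\<lambda>x. poly (P l) x * G p x))"
      by simp
  qed
  then show ?thesis
    by (simp add: legendre_proj_def poly_sum mult.commute)
qed

text \<open>
  \<open>jet m G\<close>: up to \<open>O(h\<^sup>m)\<close>, the family is a polynomial in the unscaled time \<open>h t\<close> with coefficients
  bounded in \<open>p\<close>.  This replaces the boundedness of the first \<open>m\<close> derivatives with respect to \<open>h t\<close>: it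
  holds just as well for exact solutions as for numerical curves, which depend on \<open>h\<close>, and the integral
  equations that they satisfy suffice to establish it.  Monomials of every degree \<open>k\<close> are allowed, which
  makes the class visibly closed under products.
\<close>

inductive jet :: "nat \<Rightarrow> ('p \<Rightarrow> real \<Rightarrow> real) \<Rightarrow> bool" for m where
  remainder: "unif_O m G \<Longrightarrow> (\<And>p. p \<in> I \<Longrightarrow> continuous_on {0..1} (G p)) \<Longrightarrow> jet m G"
| monomial: "unif_O 0 (\<lambda>p t. a p) \<Longrightarrow> jet m (\<lambda>p t. a p * (h p * t) ^ k)"
| add: "jet m F \<Longrightarrow> jet m G \<Longrightarrow> jet m (\<lambda>p t. F p t + G p t)"

lemma jet_continuous: "jet m G \<Longrightarrow> p \<in> I \<Longrightarrow> continuous_on {0..1} (G p)"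
  by (induction rule: jet.induct) (auto intro!: continuous_intros)

lemma unif_O_monomial:
  assumes "unif_O 0 (\<lambda>p t. a p)"
  shows "unif_O k (\<lambda>p t. a p * (h p * t) ^ k)"
proof -
  have "unif_O (0 + (k + 0)) (\<lambda>p t. a p * (h p ^ k * t ^ k))"
    by (intro unif_O_mult assms unif_O_h unif_O_indep continuous_intros)
  then show ?thesis by (simp add: power_mult_distrib)
qed

lemma jet_bounded: "jet m G \<Longrightarrow> unif_O 0 G"
proof (induction rule: jet.induct)
  case (remainder G)
  show ?case by (rule unif_O_le[OF remainder(1)]) simp
next
  case (monomial a k)
  then show ?case using unif_O_le[OF unif_O_monomial] by blast
qed (rule unif_O_add)

lemma jet_cong:
  assumes "jet m G" "\<And>p t. p \<in> I \<Longrightarrow> 0 \<le> t \<Longrightarrow> t \<le> 1 \<Longrightarrow> F p t = G p t"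
  shows "jet m F"
proof -
  have "jet m (\<lambda>p t. F p t - G p t)"
  proof (rule jet.remainder)
    show "unif_O m (\<lambda>p t. F p t - G p t)"
      using assms(2) by (intro unif_O_cong[OF unif_O_zero]) auto
    show "continuous_on {0..1} (\<lambda>t. F p t - G p t)" if "p \<in> I" for p
      using assms(2)[OF that] by (subst continuous_on_cong[of _ "{0..1}" _ "\<lambda>_. 0"]) auto
  qed
  from jet.add[OF this assms(1)] show ?thesis by simp
qed

lemma jet_const: "unif_O 0 (\<lambda>p t. a p) \<Longrightarrow> jet m (\<lambda>p t. a p)"
  using jet.monomial[of a m 0] by simp

lemma jet_le:
  assumes "jet n G" "m \<le> n"
  shows "jet m G"
  using assms(1)
proof (induction rule: jet.induct)
  case (remainder G)
  then show ?case by (intro jet.remainder unif_O_le[OF _ assms(2)])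
qed (rule jet.monomial, assumption, rule jet.add)

lemma jet_mult:
  assumes "jet m F" "jet m G"
  shows "jet m (\<lambda>p t. F p t * G p t)"
  using assms(1)
proof (induction rule: jet.induct)
  case (remainder F)
  have "unif_O (m + 0) (\<lambda>p t. F p t * G p t)"
    by (intro unif_O_mult remainder jet_bounded[OF assms(2)])
  then show ?case
    by (intro jet.remainder continuous_intros remainder jet_continuous[OF assms(2)]) simp_all
next
  case (monomial a k)
  show ?case using assms(2)
  proof (induction rule: jet.induct)
    case (remainder G)
    have "unif_O (0 + m) (\<lambda>p t. (a p * (h p * t) ^ k) * G p t)"
      by (intro unif_O_mult remainder jet_bounded[OF jet.monomial] monomial)
    then show ?case
      by (intro jet.remainder continuous_intros remainder) simp_all
  next
    case (monomial b j)
    have "unif_O (0 + 0) (\<lambda>p t. a p * b p)"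
      by (intro unif_O_mult monomial \<open>unif_O 0 (\<lambda>p t. a p)\<close>)
    then have "jet m (\<lambda>p t. (a p * b p) * (h p * t) ^ (k + j))"
      by (intro jet.monomial) simp
    then show ?case by (simp add: power_add mult_ac)
  next
    case (add F G)
    then show ?case by (auto simp: distrib_left intro: jet.add)
  qed
next
  case (add F F')
  then show ?case by (auto simp: distrib_right intro: jet.add)
qed

lemma jet_cmult: "jet m G \<Longrightarrow> jet m (\<lambda>p t. a * G p t)"
  by (intro jet_mult jet_const unif_O_indep continuous_intros)

lemma jet_diff: "jet m F \<Longrightarrow> jet m G \<Longrightarrow> jet m (\<lambda>p t. F p t - G p t)"
  using jet.add[of m F "\<lambda>p t. (-1) * G p t"] jet_cmult[of m G "-1"] by simp

lemma jet_sum: "(\<And>i. i \<in> S \<Longrightarrow> jet m (G i)) \<Longrightarrow> jet m (\<lambda>p t. \<Sum>i\<in>S. G i p t)"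
  by (induction S rule: infinite_finite_induct)
     (auto intro: jet.add jet_const[of "\<lambda>_. 0"] unif_O_zero)

text \<open>
  A power \<open>t\<^sup>i\<close> with \<open>i \<le> k\<close> that comes with the factor \<open>h\<^sup>k\<close> is \<open>(h t)\<^sup>i\<close> times the bounded \<open>h\<^sup>k\<^sup>-\<^sup>i\<close>.
\<close>

lemma jet_polynomial:
  assumes a: "unif_O 0 (\<lambda>p t. a p)" and q: "degree q \<le> k"
  shows "jet m (\<lambda>p t. a p * h p ^ k * poly q t)"
proof -
  have "jet m (\<lambda>p t. \<Sum>i\<le>k. (a p * (coeff q i * h p ^ (k - i))) * (h p * t) ^ i)"
  proof (intro jet_sum jet.monomial)
    fix i
    have "unif_O (0 + 0) (\<lambda>p t. a p * (coeff q i * h p ^ (k - i)))"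
      by (intro unif_O_mult a unif_O_cmult unif_O_le[OF unif_O_h]) simp
    then show "unif_O 0 (\<lambda>p t. a p * (coeff q i * h p ^ (k - i)))" by simp
  qed
  moreover have "a p * h p ^ k * poly q t
      = (\<Sum>i\<le>k. (a p * (coeff q i * h p ^ (k - i))) * (h p * t) ^ i)" for p t
  proof -
    have "poly q t = (\<Sum>i\<le>k. coeff q i * t ^ i)"
      unfolding poly_altdef using q
      by (intro sum.mono_neutral_left) (auto simp: coeff_eq_0)
    then have "a p * h p ^ k * poly q t = (\<Sum>i\<le>k. a p * h p ^ k * (coeff q i * t ^ i))"
      by (simp add: sum_distrib_left)
    also have "\<dots> = (\<Sum>i\<le>k. (a p * (coeff q i * h p ^ (k - i))) * (h p * t) ^ i)"
    proof (intro sum.cong refl)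
      fix i assume "i \<in> {..k}"
      then have "h p ^ k = h p ^ (k - i) * h p ^ i" by (simp flip: power_add)
      then show "a p * h p ^ k * (coeff q i * t ^ i)
          = (a p * (coeff q i * h p ^ (k - i))) * (h p * t) ^ i"
        by (simp add: power_mult_distrib mult_ac)
    qed
    finally show ?thesis .
  qed
  ultimately show ?thesis by simp
qed

text \<open>
  Integration over the unscaled time \<open>h t\<close> maps \<open>(h t)\<^sup>k\<close> to a multiple of \<open>(h t)\<^sup>k\<^sup>+\<^sup>1\<close> and adds a factor
  \<open>h\<close> to the remainder.  This gain of one order drives the proof that solutions have jets.
\<close>

lemma jet_integral:
  assumes "jet m G"
  shows "jet (Suc m) (\<lambda>p t. h p * integral {0..t} (G p))"
  using assms
proof (induction rule: jet.induct)
  case (remainder G)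
  have "unif_O (1 + m) (\<lambda>p t. h p ^ 1 * integral {0..t} (G p))"
    by (intro unif_O_mult unif_O_h unif_O_integral remainder)
  then show ?case
    by (intro jet.remainder continuous_intros indefinite_integral_continuous_1
          integrable_continuous_interval remainder) simp_all
next
  case (monomial a k)
  have "jet (Suc m) (\<lambda>p t. (1 / Suc k) * (a p * (h p * t) ^ Suc k))"
    by (intro jet_cmult jet.monomial monomial)
  then show ?case
  proof (rule jet_cong)
    fix p and t :: real assume t: "0 \<le> t" "t \<le> 1"
    have "((\<lambda>t. a p * (h p * t) ^ k) has_integral
        (a p * h p ^ k * t ^ Suc k / Suc k - a p * h p ^ k * 0 ^ Suc k / Suc k)) {0..t}"
      by (rule fundamental_theorem_of_calculus)
         (use t in \<open>auto simp: has_real_derivative_iff_has_vector_derivative[symmetric]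
            power_mult_distrib simp del: of_nat_Suc power_Suc intro!: derivative_eq_intros\<close>)
    from integral_unique[OF this]
    have "integral {0..t} (\<lambda>t. a p * (h p * t) ^ k) = a p * h p ^ k * t ^ Suc k / Suc k"
      by (simp only: power_0_Suc mult_zero_right div_0 diff_zero)
    then show "h p * integral {0..t} (\<lambda>t. a p * (h p * t) ^ k) = 1 / Suc k * (a p * (h p * t) ^ Suc k)"
      by (simp only: power_mult_distrib) simp
  qed
next
  case (add F G)
  from jet.add[OF add.IH] show ?case
  proof (rule jet_cong)
    fix p and t :: real assume t: "0 \<le> t" "t \<le> 1" and p: "p \<in> I"
    have "integral {0..t} (\<lambda>t. F p t + G p t) = integral {0..t} (F p) + integral {0..t} (G p)"
      using t
      by (intro integral_add integrable_continuous_interval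
            continuous_on_subset[OF jet_continuous[OF add.hyps(1) p]]
            continuous_on_subset[OF jet_continuous[OF add.hyps(2) p]]) auto
    then show "h p * integral {0..t} (\<lambda>t. F p t + G p t)
        = h p * integral {0..t} (F p) + h p * integral {0..t} (G p)"
      by (simp add: distrib_left)
  qed
qed

lemma jet_compose:
  fixes z :: "'p \<Rightarrow> real \<Rightarrow> 'v::euclidean_space"
  assumes "real_polynomial_function g" and z: "\<And>b. b \<in> Basis \<Longrightarrow> jet m (\<lambda>p t. z p t \<bullet> b)"
  shows "jet m (\<lambda>p t. g (z p t))"
  using assms(1)
proof (induction rule: real_polynomial_function.induct)
  case (linear f)
  have "jet m (\<lambda>p t. \<Sum>b\<in>Basis. f b * (z p t \<bullet> b))"
    by (intro jet_sum jet_cmult z)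
  then show ?case
    by (rule jet_cong) (subst linear_functional_expansion[OF linear], simp only: mult.commute)
next
  case (const c)
  show ?case by (intro jet_const unif_O_indep continuous_intros)
next
  case (add f g)
  show ?case by (rule jet.add[OF add.IH])
next
  case (mult f g)
  show ?case by (rule jet_mult[OF mult.IH])
qed

lemma legendre_proj_monomial:
  "legendre_proj P s (\<lambda>t. a * (b * t) ^ k) = smult (a * b ^ k) (legendre_proj P s (poly (monom 1 k)))"
  using legendre_proj_smult[of P s "a * b ^ k" "\<lambda>t. t ^ k"]
  by (simp add: power_mult_distrib mult_ac poly_monom[abs_def])

text \<open>
  The projection fixes \<open>t\<^sup>k\<close> if \<open>k < s\<close> and otherwise lowers its degree; in both cases the result has
  degree at most \<open>k\<close>, so that the factor \<open>h\<^sup>k\<close> of a monomial still controls it.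
\<close>

lemma jet_legendre_proj:
  assumes P: "orthonormal_legendre P" and s: "s \<ge> 1" and "jet m G"
  shows "jet m (\<lambda>p t. poly (legendre_proj P s (G p)) t)"
  using assms(3)
proof (induction rule: jet.induct)
  case (remainder G)
  then show ?case by (intro jet.remainder unif_O_legendre_proj continuous_intros) simp_all
next
  case (monomial a k)
  have "degree (legendre_proj P s (poly (monom 1 k))) \<le> k"
  proof (cases "k < s")
    case True
    then have "legendre_proj P s (poly (monom 1 k)) = monom 1 k"
      by (intro legendre_proj_id[OF P] le_less_trans[OF degree_monom_le])
    then show ?thesis by (simp add: degree_monom_le)
  next
    case False
    then show ?thesis using degree_legendre_proj[OF P s, of "poly (monom 1 k)"] by linarith
  qed
  from jet_polynomial[OF monomial this] show ?case
    by (simp only: legendre_proj_monomial poly_smult)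
next
  case (add F G)
  from jet.add[OF add.IH] show ?case
    by (rule jet_cong)
       (simp add: legendre_proj_add jet_continuous[OF add.hyps(1)] jet_continuous[OF add.hyps(2)])
qed

text \<open>
  The residual of the projection annihilates the monomials of degree less than \<open>s\<close>, and the others are
  \<open>O(h\<^sup>s)\<close>.
\<close>

lemma jet_legendre_residual:
  assumes P: "orthonormal_legendre P" and "jet s G"
  shows "unif_O s (\<lambda>p t. G p t - poly (legendre_proj P s (G p)) t)"
  using assms(2)
proof (induction rule: jet.induct)
  case (remainder G)
  then show ?case by (intro unif_O_diff unif_O_legendre_proj)
next
  case (monomial a k)
  show ?case
  proof (cases "k < s")
    case True
    then have "legendre_proj P s (poly (monom 1 k)) = monom 1 k"
      by (intro legendre_proj_id[OF P] le_less_trans[OF degree_monom_le])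
    then have "a p * (h p * t) ^ k - poly (legendre_proj P s (\<lambda>t. a p * (h p * t) ^ k)) t = 0" for p t
      by (simp only: legendre_proj_monomial poly_smult poly_monom) (simp add: power_mult_distrib)
    then show ?thesis by (simp only: unif_O_zero)
  next
    case False
    then have "unif_O s (\<lambda>p t. a p * (h p * t) ^ k)"
      by (intro unif_O_le[OF unif_O_monomial[OF monomial]]) simp
    then show ?thesis
      by (intro unif_O_diff unif_O_legendre_proj continuous_intros)
  qed
next
  case (add F G)
  from unif_O_add[OF add.IH] show ?case
    by (rule unif_O_cong)
       (simp add: legendre_proj_add jet_continuous[OF add.hyps(1)] jet_continuous[OF add.hyps(2)])
qed

text \<open>
  Orthogonality removes the part of \<open>\<psi>\<close> of degree less than \<open>s\<close>; what remains is \<open>O(h\<^sup>s)\<close>, like the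
  residual itself.  This is where the order \<open>s\<close> of the residual turns into \<open>2 s\<close>.
\<close>

lemma jet_times_orthogonal_residual:
  assumes "jet s \<psi>" and r: "unif_O s r" and c: "\<And>p. p \<in> I \<Longrightarrow> continuous_on {0..1} (r p)"
    and orth: "\<And>p q. p \<in> I \<Longrightarrow> degree q < s \<Longrightarrow> integral {0..1} (\<lambda>t. poly q t * r p t) = 0"
  shows "unif_O (s + s) (\<lambda>p _. integral {0..1} (\<lambda>t. \<psi> p t * r p t))"
  using assms(1)
proof (induction rule: jet.induct)
  case (remainder G)
  then show ?case
    by (intro unif_O_integral_1 unif_O_mult r continuous_intros c)
next
  case (monomial a k)
  show ?case
  proof (cases "k < s")
    case True
    have "integral {0..1} (\<lambda>t. a p * (h p * t) ^ k * r p t) = 0" if p: "p \<in> I" for p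
    proof -
      have "degree (smult (a p * h p ^ k) (monom 1 k)) < s"
        by (rule le_less_trans[OF _ True]) (meson degree_monom_le degree_smult_le order_trans)
      from orth[OF p this] show ?thesis
        by (simp add: poly_monom power_mult_distrib mult_ac)
    qed
    then show ?thesis by (intro unif_O_cong[OF unif_O_zero]) simp
  next
    case False
    then have "unif_O s (\<lambda>p t. a p * (h p * t) ^ k)"
      by (intro unif_O_le[OF unif_O_monomial[OF monomial]]) simp
    then show ?thesis
      by (intro unif_O_integral_1 unif_O_mult r continuous_intros c)
  qed
next
  case (add F G)
  from unif_O_add[OF add.IH] show ?case
  proof (rule unif_O_cong)
    fix p assume p: "p \<in> I"
    show "integral {0..1} (\<lambda>t. (F p t + G p t) * r p t)
        = integral {0..1} (\<lambda>t. F p t * r p t) + integral {0..1} (\<lambda>t. G p t * r p t)"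
      unfolding distrib_right
      by (intro integral_add integrable_continuous_interval continuous_intros c p
           jet_continuous[OF add.hyps(1)] jet_continuous[OF add.hyps(2)])
  qed
qed

end

section \<open>Superconvergence of the Galerkin approximation\<close>

context step_family
begin

text \<open>
  A solution of an integral equation with a polynomial right-hand side has jets of every order: if it
  has a jet of order \<open>m\<close>, so does the right-hand side, and the integral gains one order.  The operator
  \<open>K\<close> is the identity for the exact solution and the Legendre projection for the numerical curve.
\<close>

lemma curve_jets:
  fixes z :: "'p \<Rightarrow> real \<Rightarrow> 'v::euclidean_space" and f :: "'v \<Rightarrow> 'v"
  assumes f: "\<And>b. b \<in> Basis \<Longrightarrow> polyfun d (\<lambda>x. f x \<bullet> b)"
    and bdd: "\<And>b. b \<in> Basis \<Longrightarrow> unif_O 0 (\<lambda>p t. z p t \<bullet> b)"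
    and cont: "\<And>p. p \<in> I \<Longrightarrow> continuous_on {0..1} (z p)"
    and K: "\<And>n G. jet n G \<Longrightarrow> jet n (\<lambda>p. K (G p))"
    and int: "\<And>p t b. p \<in> I \<Longrightarrow> 0 \<le> t \<Longrightarrow> t \<le> 1 \<Longrightarrow> b \<in> Basis \<Longrightarrow>
      z p t \<bullet> b = z0 \<bullet> b + h p * integral {0..t} (K (\<lambda>t. f (z p t) \<bullet> b))"
  shows "b \<in> Basis \<Longrightarrow> jet m (\<lambda>p t. z p t \<bullet> b)"
proof (induction m arbitrary: b)
  case 0
  then show ?case by (intro jet.remainder bdd continuous_intros cont)
next
  case (Suc m)
  have "jet m (\<lambda>p t. f (z p t) \<bullet> b)"
    by (rule jet_compose[OF polyfun_real_polynomial_function[OF f[OF Suc.prems]] Suc.IH])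
  from jet_integral[OF K[OF this]]
  have "jet (Suc m) (\<lambda>p t. z0 \<bullet> b + h p * integral {0..t} (K (\<lambda>t. f (z p t) \<bullet> b)))"
    by (intro jet.add jet_const unif_O_indep continuous_intros)
  then show ?case by (rule jet_cong) (rule int[OF _ _ _ Suc.prems])
qed

text \<open>
  Let \<open>y' = h f(y)\<close> and \<open>u' = h \<Pi> f(u)\<close> in rescaled time, \<open>\<Pi>\<close> being the projection onto degree less
  than \<open>s\<close>.  The error \<open>e = u - y\<close> solves the linear equation \<open>e' = h (A e - r)\<close>, where
  \<open>r = f(u) - \<Pi> f(u)\<close> is \<open>O(h\<^sup>s)\<close> and orthogonal to all polynomials of degree less than \<open>s\<close>.  Hence
  \<open>e = O(h\<^sup>s\<^sup>+\<^sup>1)\<close> pointwise, but weighted integrals of \<open>e\<close> are smaller: integrated by parts, the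
  integral of \<open>\<psi> e\<close> becomes that of \<open>\<phi> (A e - r)\<close>, where \<open>\<phi>(t)\<close> is \<open>h\<close> times the integral of \<open>\<psi>\<close> from \<open>t\<close> to \<open>1\<close>.  The
  contribution of \<open>r\<close> is \<open>O(h\<^sup>2\<^sup>s)\<close> by orthogonality, and \<open>\<phi> A\<close> is a weight with an additional factor
  \<open>h\<close>.  After \<open>s\<close> repetitions the weight is \<open>O(h\<^sup>s)\<close> and the pointwise bound on \<open>e\<close> is enough.  At the
  endpoint, \<open>e(1)\<close> is \<open>h\<close> times the integral of \<open>A e\<close>, because \<open>r\<close> has mean zero.
\<close>

lemma galerkin_superconvergence:
  fixes u y :: "'p \<Rightarrow> real \<Rightarrow> 'v::euclidean_space" and f :: "'v \<Rightarrow> 'v"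
  assumes P: "orthonormal_legendre P" and s: "s \<ge> 1"
    and f: "\<And>b. b \<in> Basis \<Longrightarrow> polyfun d (\<lambda>x. f x \<bullet> b)"
    and u_bdd: "\<And>b. b \<in> Basis \<Longrightarrow> unif_O 0 (\<lambda>p t. u p t \<bullet> b)"
    and u_cont: "\<And>p. p \<in> I \<Longrightarrow> continuous_on {0..1} (u p)"
    and u_int: "\<And>p t b. p \<in> I \<Longrightarrow> 0 \<le> t \<Longrightarrow> t \<le> 1 \<Longrightarrow> b \<in> Basis \<Longrightarrow>
      u p t \<bullet> b = y0 \<bullet> b + h p * integral {0..t} (poly (legendre_proj P s (\<lambda>t. f (u p t) \<bullet> b)))"
    and y_bdd: "\<And>b. b \<in> Basis \<Longrightarrow> unif_O 0 (\<lambda>p t. y p t \<bullet> b)"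
    and y_cont: "\<And>p. p \<in> I \<Longrightarrow> continuous_on {0..1} (y p)"
    and y_int: "\<And>p t b. p \<in> I \<Longrightarrow> 0 \<le> t \<Longrightarrow> t \<le> 1 \<Longrightarrow> b \<in> Basis \<Longrightarrow>
      y p t \<bullet> b = y0 \<bullet> b + h p * integral {0..t} (\<lambda>t. f (y p t) \<bullet> b)"
    and b: "b \<in> Basis"
  shows "unif_O (2 * s + 1) (\<lambda>p t. (u p 1 - y p 1) \<bullet> b)"
proof -
  have ju: "jet s (\<lambda>p t. u p t \<bullet> b)" if "b \<in> Basis" for b
    by (rule curve_jets[where f = f and K = "\<lambda>g. poly (legendre_proj P s g)",
          OF f u_bdd u_cont jet_legendre_proj[OF P s] u_int that])
  have jy: "jet s (\<lambda>p t. y p t \<bullet> b)" if "b \<in> Basis" for b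
    by (rule curve_jets[where f = f and K = "\<lambda>g. g", OF f y_bdd y_cont _ y_int that])
  have jz: "jet s (\<lambda>p t. (u p t, y p t) \<bullet> b)" if "b \<in> Basis" for b
    using that ju jy by (auto simp: Basis_prod_def)
  obtain A where A_poly: "\<And>b j. b \<in> Basis \<Longrightarrow> real_polynomial_function (A b j)"
    and A: "\<And>b x x'. b \<in> Basis \<Longrightarrow>
      f x \<bullet> b - f x' \<bullet> b = (\<Sum>j\<in>Basis. A b j (x, x') * ((x - x') \<bullet> j))"
  proof -
    have "\<forall>b\<in>Basis. \<exists>A. (\<forall>j. real_polynomial_function (A j)) \<and>
        (\<forall>x x'. f x \<bullet> b - f x' \<bullet> b = (\<Sum>j\<in>Basis. A j (x, x') * ((x - x') \<bullet> j)))"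
      using polyfun_increment[OF f] by blast
    then obtain A where "\<forall>b\<in>Basis. (\<forall>j. real_polynomial_function (A b j)) \<and>
        (\<forall>x x'. f x \<bullet> b - f x' \<bullet> b = (\<Sum>j\<in>Basis. A b j (x, x') * ((x - x') \<bullet> j)))"
      by (rule bchoice[THEN exE])
    then show ?thesis using that by blast
  qed
  define a where "a b j p t = A b j (u p t, y p t)" for b j p t
  define e where "e b p t = (u p t - y p t) \<bullet> b" for b p t
  define F where "F b p t = f (u p t) \<bullet> b" for b p t
  define r where "r b p t = F b p t - poly (legendre_proj P s (F b p)) t" for b p t
  define g where "g b p t = (\<Sum>j\<in>Basis. a b j p t * e j p t) - r b p t" for b p t
  have ja: "jet s (a b j)" if "b \<in> Basis" for b j
    unfolding a_def by (rule jet_compose[OF A_poly[OF that] jz])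
  have jF: "jet s (F b)" if "b \<in> Basis" for b
    unfolding F_def by (rule jet_compose[OF polyfun_real_polynomial_function[OF f[OF that]] ju])
  have cF: "continuous_on {0..1} (F b p)" if "b \<in> Basis" "p \<in> I" for b p
    by (rule jet_continuous[OF jF[OF that(1)] that(2)])
  have ca: "continuous_on {0..1} (a b j p)" if "b \<in> Basis" "p \<in> I" for b j p
    by (rule jet_continuous[OF ja[OF that(1)] that(2)])
  have ce: "continuous_on {0..1} (e b p)" if "p \<in> I" for b p
    unfolding e_def by (intro continuous_intros u_cont y_cont that)
  have cr: "continuous_on {0..1} (r b p)" if "b \<in> Basis" "p \<in> I" for b p
    unfolding r_def by (intro continuous_intros cF that)
  have cg: "continuous_on {0..1} (g b p)" if "b \<in> Basis" "p \<in> I" for b p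
    unfolding g_def by (intro continuous_intros ca ce cr that)
  have r: "unif_O s (r b)" if "b \<in> Basis" for b
    unfolding r_def by (rule jet_legendre_residual[OF P jF[OF that]])
  have orth: "integral {0..1} (\<lambda>t. poly q t * r b p t) = 0"
    if "b \<in> Basis" "p \<in> I" "degree q < s" for b p q
    unfolding r_def by (rule legendre_proj_residual_orthogonal[OF P that(3) cF[OF that(1,2)]])
  (* Subtracting the two integral equations leaves the projection of f(u) minus f(y), which is
     f(u) - f(y) - r, and the increment f(u) - f(y) is linear in e. *)
  have e_int: "e b p t = h p * integral {0..t} (g b p)"
    if "b \<in> Basis" "p \<in> I" "0 \<le> t" "t \<le> 1" for b p t
  proof -
    have cy: "continuous_on {0..1} (\<lambda>t. f (y p t) \<bullet> b)"
      by (rule jet_continuous[OF _ that(2)], rule jet_compose[OF polyfun_real_polynomial_function[OF f[OF that(1)]] jy])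
    have sub: "{0..t} \<subseteq> {0..1}" using that by simp
    have "g b p = (\<lambda>t. poly (legendre_proj P s (F b p)) t - f (y p t) \<bullet> b)"
      by (rule ext) (simp add: g_def a_def e_def r_def F_def flip: A[OF that(1)] del: inner_diff_left)
    then have "integral {0..t} (g b p)
        = integral {0..t} (poly (legendre_proj P s (F b p))) - integral {0..t} (\<lambda>t. f (y p t) \<bullet> b)"
      by (simp only:)
         (intro integral_diff integrable_continuous_interval continuous_on_subset[OF cy sub] continuous_intros)
    then show ?thesis
      using u_int[OF that(2,3,4,1)] y_int[OF that(2,3,4,1)]
      by (simp add: e_def F_def[abs_def] inner_diff_left right_diff_distrib)
  qed
  (* Each pass through the integral equation gains a factor h, until the size of r stops the gain. *)
  have e_small: "m \<le> s + 1 \<Longrightarrow> b \<in> Basis \<Longrightarrow> unif_O m (e b)" for m b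
  proof (induction m arbitrary: b)
    case 0
    show ?case
      unfolding e_def inner_diff_left by (intro unif_O_diff u_bdd y_bdd 0)
  next
    case (Suc m)
    have "unif_O m (\<lambda>p t. a b j p t * e j p t)" if "j \<in> Basis" for j
      using unif_O_mult[OF jet_bounded[OF ja[OF Suc.prems(2), of j]] Suc.IH[OF _ that]] Suc.prems(1) by simp
    moreover have "unif_O m (r b)"
      using Suc.prems by (intro unif_O_le[OF r]) auto
    ultimately have "unif_O m (g b)"
      unfolding g_def by (intro unif_O_diff unif_O_sum)
    then have "unif_O (1 + m) (\<lambda>p t. h p ^ 1 * integral {0..t} (g b p))"
      by (intro unif_O_mult unif_O_h unif_O_integral cg Suc.prems)
    then have "unif_O (Suc m) (\<lambda>p t. h p * integral {0..t} (g b p))" by simp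
    then show ?case by (rule unif_O_cong) (rule e_int[OF Suc.prems(2)])
  qed
  (* n counts the powers of h in the weight and m the integrations by parts still available.
     The order 2s is enough, as the integral equation supplies one more factor h at the end. *)
  have weighted: "unif_O (2 * s) (\<lambda>p _. integral {0..1} (\<lambda>t. \<psi> p t * e b p t))"
    if "jet s \<psi>" "unif_O n \<psi>" "s \<le> n + m" "b \<in> Basis" for \<psi> n m b
    using that
  proof (induction m arbitrary: \<psi> n b)
    case 0
    have "unif_O (n + s) (\<lambda>p _. integral {0..1} (\<lambda>t. \<psi> p t * e b p t))"
      by (intro unif_O_integral_1 unif_O_mult 0 e_small continuous_intros ce jet_continuous[OF 0(1)]) simp
    then show ?case by (rule unif_O_le) (use 0 in simp)
  next
    case (Suc m)
    define \<phi> where "\<phi> p t = h p * (integral {0..1} (\<psi> p) - integral {0..t} (\<psi> p))" for p t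
    have c\<psi>: "continuous_on {0..1} (\<psi> p)" if "p \<in> I" for p
      by (rule jet_continuous[OF Suc.prems(1) that])
    have U: "unif_O (1 + j) (\<lambda>p t. h p ^ 1 * integral {0..1} (\<psi> p))" if "unif_O j \<psi>" for j
      by (intro unif_O_mult unif_O_h unif_O_integral_1 c\<psi> that)
    have "unif_O (1 + n) (\<lambda>p t. h p ^ 1 * (integral {0..1} (\<psi> p) - integral {0..t} (\<psi> p)))"
      by (intro unif_O_mult unif_O_h unif_O_diff unif_O_integral_1 unif_O_integral c\<psi> Suc.prems)
    then have O\<phi>: "unif_O (Suc n) \<phi>" by (simp add: \<phi>_def[abs_def])
    have "jet s (\<lambda>p t. h p * integral {0..1} (\<psi> p) - h p * integral {0..t} (\<psi> p))"
      by (intro jet_diff jet_const jet_le[OF jet_integral[OF Suc.prems(1)]])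
         (use unif_O_le[OF U[OF jet_bounded[OF Suc.prems(1)]]] in simp_all)
    then have j\<phi>: "jet s \<phi>" by (simp add: \<phi>_def[abs_def] right_diff_distrib)
    have c\<phi>: "continuous_on {0..1} (\<phi> p)" if "p \<in> I" for p
      by (rule jet_continuous[OF j\<phi> that])
    have "unif_O (2 * s) (\<lambda>p _. integral {0..1} (\<lambda>t. \<phi> p t * a b j p t * e j p t))"
      if j: "j \<in> Basis" for j
    proof (rule Suc.IH)
      show "jet s (\<lambda>p t. \<phi> p t * a b j p t)" by (intro jet_mult j\<phi> ja Suc.prems)
      have "unif_O (Suc n + 0) (\<lambda>p t. \<phi> p t * a b j p t)"
        by (intro unif_O_mult O\<phi> jet_bounded[OF ja] Suc.prems)
      then show "unif_O (Suc n) (\<lambda>p t. \<phi> p t * a b j p t)" by simp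
    qed (use Suc.prems j in auto)
    moreover have "unif_O (s + s) (\<lambda>p _. integral {0..1} (\<lambda>t. \<phi> p t * r b p t))"
      by (rule jet_times_orthogonal_residual[OF j\<phi> r cr orth]) (use Suc.prems in auto)
    ultimately have "unif_O (2 * s) (\<lambda>p _.
        (\<Sum>j\<in>Basis. integral {0..1} (\<lambda>t. \<phi> p t * a b j p t * e j p t))
        - integral {0..1} (\<lambda>t. \<phi> p t * r b p t))"
      by (intro unif_O_diff unif_O_sum) (simp_all add: mult_2)
    then show ?case
    proof (rule unif_O_cong)
      fix p assume p: "p \<in> I"
      note c = c\<psi>[OF p] c\<phi>[OF p] ca[OF Suc.prems(4) p] cr[OF Suc.prems(4) p] ce[OF p]
      have "integral {0..1} (\<lambda>t. \<psi> p t * e b p t)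
          = integral {0..1} (\<lambda>t. h p * (\<psi> p t * integral {0..t} (g b p)))"
        by (rule integral_cong) (simp add: e_int[OF Suc.prems(4) p])
      also have "\<dots> = integral {0..1} (\<lambda>t. \<phi> p t * g b p t)"
        using integral_by_parts_primitives[OF c\<psi>[OF p] cg[OF Suc.prems(4) p]]
        by (simp add: \<phi>_def mult.assoc)
      also have "\<dots> = integral {0..1} (\<lambda>t. (\<Sum>j\<in>Basis. \<phi> p t * a b j p t * e j p t) - \<phi> p t * r b p t)"
        by (simp add: g_def right_diff_distrib sum_distrib_left mult.assoc)
      also have "\<dots> = integral {0..1} (\<lambda>t. \<Sum>j\<in>Basis. \<phi> p t * a b j p t * e j p t)
          - integral {0..1} (\<lambda>t. \<phi> p t * r b p t)"
        by (intro integral_diff integrable_continuous_interval continuous_intros c)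
      also have "integral {0..1} (\<lambda>t. \<Sum>j\<in>Basis. \<phi> p t * a b j p t * e j p t)
          = (\<Sum>j\<in>Basis. integral {0..1} (\<lambda>t. \<phi> p t * a b j p t * e j p t))"
        by (intro integral_sum integrable_continuous_interval continuous_intros c finite_Basis)
      finally show "integral {0..1} (\<lambda>t. \<psi> p t * e b p t)
          = (\<Sum>j\<in>Basis. integral {0..1} (\<lambda>t. \<phi> p t * a b j p t * e j p t))
            - integral {0..1} (\<lambda>t. \<phi> p t * r b p t)" .
    qed
  qed
  have "unif_O (1 + 2 * s) (\<lambda>p t. h p ^ 1 * (\<Sum>j\<in>Basis. integral {0..1} (\<lambda>t. a b j p t * e j p t)))"
    by (intro unif_O_mult unif_O_h unif_O_sum weighted[where n = 0 and m = s] ja[OF b]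
          jet_bounded[OF ja[OF b]]) simp_all
  then have "unif_O (2 * s + 1) (\<lambda>p t. h p * (\<Sum>j\<in>Basis. integral {0..1} (\<lambda>t. a b j p t * e j p t)))"
    by simp
  then show ?thesis
  proof (rule unif_O_cong)
    fix p assume p: "p \<in> I"
    note c = ca[OF b p] cr[OF b p] ce[OF p]
    have "integral {0..1} (g b p)
        = integral {0..1} (\<lambda>t. \<Sum>j\<in>Basis. a b j p t * e j p t) - integral {0..1} (r b p)"
      unfolding g_def
      by (intro integral_diff integrable_continuous_interval continuous_intros c)
    also have "integral {0..1} (r b p) = 0"
      using orth[OF b p, of "[:1:]"] s by simp
    also have "integral {0..1} (\<lambda>t. \<Sum>j\<in>Basis. a b j p t * e j p t)
        = (\<Sum>j\<in>Basis. integral {0..1} (\<lambda>t. a b j p t * e j p t))"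
      by (intro integral_sum integrable_continuous_interval continuous_intros c finite_Basis)
    finally show "(u p 1 - y p 1) \<bullet> b = h p * (\<Sum>j\<in>Basis. integral {0..1} (\<lambda>t. a b j p t * e j p t))"
      using e_int[OF b p, of 1] by (simp add: e_def)
  qed
qed

end

section \<open>Solvability of the stage equations\<close>

text \<open>
  For small \<open>h\<close> the stage map takes the ball of radius \<open>R\<close> into itself and contracts distances by the
  factor \<open>1/2\<close> in the maximum norm over the stages, so the Picard iteration started at \<open>y0\<close> converges.
\<close>

lemma rk_stages_solvable:
  fixes f :: "'v::euclidean_space \<Rightarrow> 'v"
  assumes R: "R > 0"
    and L: "L-lipschitz_on (cball y0 R) f"
  shows "\<forall>\<^sub>F h in at_right 0. \<exists>Y. rk_stages k A f h y0 Y \<and> (\<forall>i<k. dist (Y i) y0 \<le> R)"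
proof -
  define M where "M = (\<Sum>i<k. \<Sum>j<k. \<bar>A i j\<bar>)"
  define B where "B = norm (f y0) + L * R"
  have M0: "M \<ge> 0" by (simp add: M_def sum_nonneg)
  have L0: "L \<ge> 0" using L by (simp add: lipschitz_on_def)
  have B: "norm (f x) \<le> B" if "x \<in> cball y0 R" for x
  proof -
    have "norm (f x - f y0) \<le> L * dist x y0"
      using lipschitz_onD[OF L that, of y0] R by (simp add: dist_norm)
    also have "\<dots> \<le> L * R" using that L0 by (intro mult_left_mono) (auto simp: dist_commute)
    finally show ?thesis using norm_triangle_sub[of "f x" "f y0"] by (simp add: B_def)
  qed
  have B0: "B \<ge> 0" using L0 R by (simp add: B_def)
  have row: "(\<Sum>j<k. \<bar>A i j\<bar>) \<le> M" if "i < k" for i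
    unfolding M_def using that by (intro member_le_sum) (auto intro: sum_nonneg)
  have comb: "norm (\<Sum>j<k. A i j *\<^sub>R v j) \<le> M * K"
    if "i < k" "0 \<le> K" "\<And>j. j < k \<Longrightarrow> norm (v j) \<le> K" for i K and v :: "nat \<Rightarrow> 'v"
  proof -
    have "norm (\<Sum>j<k. A i j *\<^sub>R v j) \<le> (\<Sum>j<k. \<bar>A i j\<bar> * K)"
      using that by (intro order_trans[OF norm_sum] sum_mono) (auto intro: mult_left_mono)
    also have "\<dots> \<le> M * K"
      using row[OF that(1)] that(2) by (simp flip: sum_distrib_right add: mult_right_mono)
    finally show ?thesis .
  qed
  have solve: "\<exists>Y. rk_stages k A f h y0 Y \<and> (\<forall>i<k. dist (Y i) y0 \<le> R)"
    if h: "0 \<le> h" "h * (M * B) \<le> R" "h * (M * L) \<le> 1/2" for h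
  proof -
    define T where "T Y i = (if i < k then y0 + h *\<^sub>R (\<Sum>j<k. A i j *\<^sub>R f (Y j)) else y0)"
      for Y :: "nat \<Rightarrow> 'v" and i
    have T_ball: "T Y i \<in> cball y0 R" if "\<And>i. Y i \<in> cball y0 R" for Y i
    proof (cases "i < k")
      case True
      have "norm (h *\<^sub>R (\<Sum>j<k. A i j *\<^sub>R f (Y j))) \<le> h * (M * B)"
        using comb[OF True B0, of "\<lambda>j. f (Y j)"] B that h(1) by (simp add: mult_left_mono)
      then show ?thesis using True h(2) by (simp add: T_def dist_norm)
    qed (use R in \<open>simp add: T_def\<close>)
    have T_contract: "norm (T Y i - T Z i) \<le> 1/2 * K"
      if YZ: "\<And>i. Y i \<in> cball y0 R" "\<And>i. Z i \<in> cball y0 R"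
        and K: "0 \<le> K" "\<And>i. norm (Y i - Z i) \<le> K" for Y Z i K
    proof (cases "i < k")
      case True
      have "norm (f (Y j) - f (Z j)) \<le> L * K" for j
      proof -
        have "norm (f (Y j) - f (Z j)) \<le> L * norm (Y j - Z j)"
          using lipschitz_onD[OF L YZ(1)[of j] YZ(2)[of j]] by (simp add: dist_norm)
        also have "\<dots> \<le> L * K" by (intro mult_left_mono K L0)
        finally show ?thesis .
      qed
      then have "norm (\<Sum>j<k. A i j *\<^sub>R (f (Y j) - f (Z j))) \<le> M * (L * K)"
        using L0 K(1) by (intro comb[OF True]) auto
      then have "h * norm (\<Sum>j<k. A i j *\<^sub>R (f (Y j) - f (Z j))) \<le> h * (M * (L * K))"
        using h(1) by (rule mult_left_mono)
      also have "\<dots> = (h * (M * L)) * K" by simp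
      also have "\<dots> \<le> 1/2 * K" using h(3) K(1) by (rule mult_right_mono)
      finally have "norm (h *\<^sub>R (\<Sum>j<k. A i j *\<^sub>R (f (Y j) - f (Z j)))) \<le> 1/2 * K"
        using h(1) by simp
      then show ?thesis
        using True by (simp add: T_def scaleR_diff_right sum_subtractf)
    qed (use K in \<open>simp add: T_def\<close>)
    define X where "X n = (T ^^ n) (\<lambda>_. y0)" for n
    have X_Suc: "X (Suc n) = T (X n)" for n by (simp add: X_def)
    have X_ball: "X n i \<in> cball y0 R" for n i
    proof (induction n arbitrary: i)
      case 0
      show ?case using R by (simp add: X_def)
    next
      case (Suc n)
      show ?case unfolding X_Suc by (rule T_ball[OF Suc.IH])
    qed
    have X_step: "norm (X (Suc n) i - X n i) \<le> R * (1/2) ^ n" for n i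
    proof (induction n arbitrary: i)
      case 0
      show ?case using X_ball[of 1 i] by (simp add: X_def dist_norm norm_minus_commute)
    next
      case (Suc n)
      have "norm (T (X (Suc n)) i - T (X n) i) \<le> 1/2 * (R * (1/2) ^ n)"
        by (rule T_contract[OF X_ball X_ball _ Suc.IH]) (use R in simp)
      then show ?case by (simp add: X_Suc)
    qed
    have "convergent (\<lambda>n. X n i)" for i
    proof -
      have "summable (\<lambda>n. R * (1/2) ^ n)" by (intro summable_mult summable_geometric) simp
      then have "summable (\<lambda>n. X (Suc n) i - X n i)"
        by (rule summable_comparison_test') (rule X_step)
      then show ?thesis
        using sum_lessThan_telescope[of "\<lambda>n. X n i"]
        by (simp add: summable_iff_convergent convergent_diff_const_right_iff)
    qed
    then obtain Y where lim: "\<And>i. (\<lambda>n. X n i) \<longlonglongrightarrow> Y i" unfolding convergent_def by metis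
    have Y_ball: "Y i \<in> cball y0 R" for i
      by (rule closed_sequentially[OF closed_cball _ lim[of i]]) (rule X_ball)
    have "Y i = y0 + h *\<^sub>R (\<Sum>j<k. A i j *\<^sub>R f (Y j))" if "i < k" for i
    proof (rule LIMSEQ_unique)
      show "(\<lambda>n. X (Suc n) i) \<longlonglongrightarrow> Y i" by (rule LIMSEQ_Suc[OF lim])
      have "(\<lambda>n. f (X n j)) \<longlonglongrightarrow> f (Y j)" for j
        by (rule continuous_on_tendsto_compose[OF lipschitz_on_continuous_on[OF L] lim Y_ball])
           (use X_ball in simp)
      then show "(\<lambda>n. X (Suc n) i) \<longlonglongrightarrow> y0 + h *\<^sub>R (\<Sum>j<k. A i j *\<^sub>R f (Y j))"
        using that by (auto simp: X_Suc T_def intro!: tendsto_intros)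
    qed
    then have "rk_stages k A f h y0 Y" unfolding rk_stages_def by blast
    moreover have "dist (Y i) y0 \<le> R" for i using Y_ball[of i] by (simp add: dist_commute)
    ultimately show ?thesis by blast
  qed
  have small: "\<forall>\<^sub>F h in at_right 0. h * K < \<delta>" if "\<delta> > 0" for K \<delta> :: real
  proof -
    have "((\<lambda>h. h * K) \<longlongrightarrow> 0 * K) (at_right 0)" by (intro tendsto_intros)
    then show ?thesis using that by (intro order_tendstoD(2)) auto
  qed
  have "\<forall>\<^sub>F h in at_right (0::real). h > 0" by (rule eventually_at_right_less)
  then show ?thesis
    using small[OF R, of "M * B"] small[OF half_gt_zero[OF zero_less_one], of "M * L"]
  proof eventually_elim
    case (elim h)
    then show ?case by (intro solve) auto
  qed
qed

lemma polyfun_field_lipschitz: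
  fixes f :: "'v::euclidean_space \<Rightarrow> 'v"
  assumes f: "\<And>b. b \<in> Basis \<Longrightarrow> polyfun d (\<lambda>x. f x \<bullet> b)"
  shows "\<exists>L. L-lipschitz_on (cball y0 R) f"
proof -
  let ?S = "cball y0 R"
  have "\<exists>K\<ge>0. \<forall>x\<in>?S. \<forall>x'\<in>?S. \<bar>f x \<bullet> b - f x' \<bullet> b\<bar> \<le> K * norm (x - x')" if b: "b \<in> Basis" for b
  proof -
    obtain A where A: "\<And>j. real_polynomial_function (A j)"
      "\<And>x x'. f x \<bullet> b - f x' \<bullet> b = (\<Sum>j\<in>Basis. A j (x, x') * ((x - x') \<bullet> j))"
      using polyfun_increment[OF f[OF b]] by blast
    have "\<exists>K. \<forall>z\<in>?S \<times> ?S. \<bar>A j z\<bar> \<le> K" for j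
    proof -
      have "continuous_on (?S \<times> ?S) (A j)"
        using A(1)[of j] by (simp add: real_polynomial_function_eq continuous_on_polymonial_function)
      then have "bounded (A j ` (?S \<times> ?S))"
        by (intro compact_imp_bounded compact_continuous_image compact_Times compact_cball)
      then show ?thesis by (auto simp: bounded_iff)
    qed
    then obtain K where K: "\<And>j z. z \<in> ?S \<times> ?S \<Longrightarrow> \<bar>A j z\<bar> \<le> K j" by metis
    have "\<bar>f x \<bullet> b - f x' \<bullet> b\<bar> \<le> (\<Sum>j\<in>Basis. \<bar>K j\<bar>) * norm (x - x')" if "x \<in> ?S" "x' \<in> ?S" for x x'
    proof -
      have "\<bar>A j (x, x') * ((x - x') \<bullet> j)\<bar> \<le> \<bar>K j\<bar> * norm (x - x')" if "j \<in> Basis" for j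
        unfolding abs_mult
        using K[of "(x, x')" j] Basis_le_norm[OF that] \<open>x \<in> ?S\<close> \<open>x' \<in> ?S\<close>
        by (intro mult_mono) (auto intro: order_trans[OF _ abs_ge_self])
      then show ?thesis
        unfolding A(2) sum_distrib_right by (intro order_trans[OF sum_abs] sum_mono)
    qed
    then show ?thesis by (intro exI[of _ "\<Sum>j\<in>Basis. \<bar>K j\<bar>"]) (auto intro: sum_nonneg)
  qed
  then obtain K where K0: "\<And>b. b \<in> Basis \<Longrightarrow> K b \<ge> 0"
    and K: "\<And>b x x'. b \<in> Basis \<Longrightarrow> x \<in> ?S \<Longrightarrow> x' \<in> ?S \<Longrightarrow> \<bar>f x \<bullet> b - f x' \<bullet> b\<bar> \<le> K b * norm (x - x')"
    by metis
  have "(\<Sum>b\<in>Basis. K b)-lipschitz_on ?S f"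
  proof (rule lipschitz_onI)
    fix x x' assume x: "x \<in> ?S" "x' \<in> ?S"
    have "norm (f x - f x') \<le> (\<Sum>b\<in>Basis. \<bar>(f x - f x') \<bullet> b\<bar>)" by (rule norm_le_l1)
    also have "\<dots> \<le> (\<Sum>b\<in>Basis. K b * norm (x - x'))"
      by (intro sum_mono) (simp add: inner_diff_left K x del: mem_cball)
    finally show "dist (f x) (f x') \<le> (\<Sum>b\<in>Basis. K b) * dist x x'"
      by (simp add: dist_norm sum_distrib_right)
  qed (use K0 in \<open>auto intro: sum_nonneg\<close>)
  then show ?thesis by blast
qed

section \<open>The order of HBVM for polynomial vector fields\<close>

lemma rescaled_solution_integral:
  fixes y :: "real \<Rightarrow> 'v::euclidean_space" and f :: "'v \<Rightarrow> 'v"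
  assumes y: "\<And>t. t \<in> {0..T} \<Longrightarrow> (y has_vector_derivative f (y t)) (at t within {0..T})"
    and h: "0 < h" "h \<le> T" and t: "0 \<le> t" "t \<le> 1"
  shows "y (h * t) \<bullet> b = y 0 \<bullet> b + h * integral {0..t} (\<lambda>t. f (y (h * t)) \<bullet> b)"
proof -
  have "((\<lambda>t. h * (f (y (h * t)) \<bullet> b)) has_integral (y (h * t) \<bullet> b - y (h * 0) \<bullet> b)) {0..t}"
  proof (rule fundamental_theorem_of_calculus)
    fix x assume x: "x \<in> {0..t}"
    have range: "h * v \<in> {0..T}" if "v \<in> {0..t}" for v
      using that h t mult_mono[of h T v 1] by auto
    have "((\<lambda>x. h * x) has_vector_derivative h) (at x within {0..t})"
      by (auto intro!: derivative_eq_intros)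
    moreover have "(y has_vector_derivative f (y (h * x))) (at (h * x) within (\<lambda>x. h * x) ` {0..t})"
      by (rule has_vector_derivative_within_subset[OF y]) (use range x in auto)
    ultimately have "(y \<circ> (\<lambda>x. h * x) has_vector_derivative h *\<^sub>R f (y (h * x))) (at x within {0..t})"
      by (rule vector_diff_chain_within)
    from bounded_linear.has_vector_derivative[OF bounded_linear_inner_left[of b] this]
    show "((\<lambda>x. y (h * x) \<bullet> b) has_vector_derivative h * (f (y (h * x)) \<bullet> b)) (at x within {0..t})"
      by (simp add: o_def)
  qed (use t in simp)
  then show ?thesis by (simp add: integral_unique flip: integral_mult_right)
qed

text \<open>
  Along the curve \<open>u\<close> of the step, \<open>P l\<close> times a component of \<open>f(u)\<close> has degree at most
  \<open>(s - 1) + d s < 2 k\<close>.  The quadrature coefficients are therefore the exact Legendre coefficients,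
  and \<open>u'\<close> is \<open>h\<close> times the orthogonal projection of \<open>f(u)\<close>.
\<close>

lemma hbvm_curve_galerkin:
  fixes f :: "'v::euclidean_space \<Rightarrow> 'v"
  assumes P: "orthonormal_legendre P" and G: "gauss_legendre P k c \<omega>"
    and f: "\<And>b. b \<in> Basis \<Longrightarrow> polyfun d (\<lambda>x. f x \<bullet> b)" and deg: "(d + 1) * s \<le> 2 * k"
    and st: "rk_stages k (hbvm_matrix P c \<omega> s) f h y0 Y"
    and b: "b \<in> Basis" and t: "0 \<le> t"
  defines "u \<equiv> hbvm_curve P c \<omega> s k f h y0 Y"
  shows "u t \<bullet> b = y0 \<bullet> b + h * integral {0..t} (poly (legendre_proj P s (\<lambda>t. f (u t) \<bullet> b)))"
proof -
  obtain p where p: "degree p \<le> d * s" "\<And>t. f (u t) \<bullet> b = poly p t"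
    using polyfun_along_polynomial_curve[OF f[OF b] hbvm_curve_polynomial[OF P]] unfolding u_def by blast
  have node: "u (c i) = Y i" if "i < k" for i
    using G hbvm_curve_node[OF st that] that by (auto simp: u_def gauss_legendre_def)
  have coeff: "integral {0..1} (\<lambda>t. poly (P l) t * (f (u t) \<bullet> b)) = legendre_coeff P c \<omega> k f Y l \<bullet> b"
    if "l < s" for l
  proof -
    have "degree (P l * p) < 2 * k"
      using degree_mult_le[of "P l" p] p(1) deg that degree_legendre[OF P, of l] by simp
    then have "integral {0..1} (poly (P l * p)) = (\<Sum>i<k. \<omega> i * poly (P l * p) (c i))"
      by (rule gauss_legendre_exact[OF P G])
    moreover have "poly (P l * p) = (\<lambda>t. poly (P l) t * (f (u t) \<bullet> b))"
      by (rule ext) (simp add: p(2))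
    ultimately show ?thesis
      by (simp add: legendre_coeff_def inner_sum_left node mult.assoc)
  qed
  have "integral {0..t} (poly (legendre_proj P s (\<lambda>t. f (u t) \<bullet> b)))
      = integral {0..t} (\<lambda>x. \<Sum>l<s. (legendre_coeff P c \<omega> k f Y l \<bullet> b) *\<^sub>R poly (P l) x)"
    by (intro arg_cong[where f = "integral {0..t}"] ext) (simp add: legendre_proj_def poly_sum coeff)
  also have "\<dots> = (\<Sum>l<s. (legendre_coeff P c \<omega> k f Y l \<bullet> b) *\<^sub>R integral {0..t} (poly (P l)))"
    by (subst integral_sum) (auto intro!: integrable_continuous_interval continuous_intros)
  also have "h * \<dots> = u t \<bullet> b - y0 \<bullet> b"
    by (simp add: integral_poly_from_0[OF t] u_def hbvm_curve_def inner_add_left inner_sum_left mult.commute)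
  finally show ?thesis by simp
qed

text \<open>
  The members of the family are the pairs of a stepsize \<open>h \<le> min 1 T\<close> and stages within the distance
  \<open>R\<close>; the bound on the stages bounds the curves uniformly, which starts the argument for their jets.
\<close>

theorem hbvm_order:
  fixes f :: "'v::euclidean_space \<Rightarrow> 'v" and y :: "real \<Rightarrow> 'v"
  assumes P: "orthonormal_legendre P" and G: "gauss_legendre P k c \<omega>" and s: "s \<ge> 1"
    and f: "\<And>b. b \<in> Basis \<Longrightarrow> polyfun d (\<lambda>x. f x \<bullet> b)" and deg: "(d + 1) * s \<le> 2 * k"
    and T: "0 < T"
    and y: "\<And>t. t \<in> {0..T} \<Longrightarrow> (y has_vector_derivative f (y t)) (at t within {0..T})"
  shows "rk_order k (hbvm_matrix P c \<omega> s) \<omega> f y (2 * s)"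
  unfolding rk_order_def
proof (intro allI impI conjI)
  fix R :: real assume R: "R > 0"
  show "\<forall>\<^sub>F h in at_right 0. \<exists>Y. rk_stages k (hbvm_matrix P c \<omega> s) f h (y 0) Y \<and> (\<forall>i<k. dist (Y i) (y 0) \<le> R)"
    using polyfun_field_lipschitz[OF f, of "y 0" R] rk_stages_solvable[OF R] by blast
  define I where "I = {(h, Y). 0 < h \<and> h \<le> min 1 T \<and> rk_stages k (hbvm_matrix P c \<omega> s) f h (y 0) Y
      \<and> (\<forall>i<k. dist (Y i) (y 0) \<le> R)}"
  define u where "u p = hbvm_curve P c \<omega> s k f (fst p) (y 0) (snd p)" for p
  define z where "z p t = y (fst p * t)" for p :: "real \<times> (nat \<Rightarrow> 'v)" and t
  interpret step_family I fst by standard (auto simp: I_def)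
  have range: "fst p * t \<in> {0..T}" if "p \<in> I" "0 \<le> t" "t \<le> 1" for p t
    using that mult_mono[of "fst p" T t 1] by (auto simp: I_def)
  have ycont: "continuous_on {0..T} y"
    using has_vector_derivative_continuous[OF y] by (simp add: continuous_on_eq_continuous_within)
  have zcont: "continuous_on {0..1} (z p)" if "p \<in> I" for p
    unfolding z_def
    by (intro continuous_on_compose2[OF ycont] continuous_intros) (use range[OF that] in auto)
  have ucont: "continuous_on {0..1} (u p)" for p
    unfolding u_def hbvm_curve_def by (intro continuous_intros)
  have z_bdd: "unif_O 0 (\<lambda>p t. z p t \<bullet> b)" for b
  proof -
    have "bounded ((\<lambda>t. y t \<bullet> b) ` {0..T})"
      by (intro compact_imp_bounded compact_continuous_image continuous_intros ycont) simp
    then obtain B where "\<forall>t\<in>{0..T}. \<bar>y t \<bullet> b\<bar> \<le> B" by (auto simp: bounded_iff)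
    then show ?thesis using range by (intro unif_OI[of _ B]) (auto simp: z_def)
  qed
  have stage_bdd: "unif_O 0 (\<lambda>p t. f (snd p j) \<bullet> b)" if "b \<in> Basis" "j < k" for b j
  proof -
    have "bounded ((\<lambda>x. f x \<bullet> b) ` cball (y 0) R)"
      by (intro compact_imp_bounded compact_continuous_image polyfun_continuous[OF f[OF that(1)]]) simp
    then obtain B where "\<forall>x\<in>cball (y 0) R. \<bar>f x \<bullet> b\<bar> \<le> B" by (auto simp: bounded_iff)
    then show ?thesis
      using that(2) by (intro unif_OI[of _ B]) (auto simp: I_def dist_commute)
  qed
  have u_bdd: "unif_O 0 (\<lambda>p t. u p t \<bullet> b)" if "b \<in> Basis" for b
  proof -
    have "unif_O 0 (\<lambda>p t. fst p ^ 1 * (\<Sum>l<s. poly (antideriv (P l)) t *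
        (\<Sum>j<k. (\<omega> j * poly (P l) (c j)) * (f (snd p j) \<bullet> b))))"
    proof (rule unif_O_le[OF unif_O_mult[OF unif_O_h]])
      show "unif_O 0 (\<lambda>p t. \<Sum>l<s. poly (antideriv (P l)) t *
        (\<Sum>j<k. (\<omega> j * poly (P l) (c j)) * (f (snd p j) \<bullet> b)))"
      proof (rule unif_O_sum)
        fix l
        have "unif_O (0 + 0) (\<lambda>p t. poly (antideriv (P l)) t *
          (\<Sum>j<k. (\<omega> j * poly (P l) (c j)) * (f (snd p j) \<bullet> b)))"
          by (intro unif_O_mult unif_O_indep unif_O_sum unif_O_cmult stage_bdd that continuous_intros) simp
        then show "unif_O 0 (\<lambda>p t. poly (antideriv (P l)) t *
          (\<Sum>j<k. (\<omega> j * poly (P l) (c j)) * (f (snd p j) \<bullet> b)))" by simp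
      qed
    qed simp
    then have "unif_O 0 (\<lambda>p t. y 0 \<bullet> b + fst p ^ 1 * (\<Sum>l<s. poly (antideriv (P l)) t *
        (\<Sum>j<k. (\<omega> j * poly (P l) (c j)) * (f (snd p j) \<bullet> b))))"
      by (intro unif_O_add unif_O_indep continuous_intros)
    then show ?thesis
      by (simp add: u_def hbvm_curve_def legendre_coeff_def inner_add_left inner_sum_left)
  qed
  have "unif_O (2 * s + 1) (\<lambda>p t. (u p 1 - z p 1) \<bullet> b)" if b: "b \<in> Basis" for b
  proof (rule galerkin_superconvergence[OF P s f u_bdd ucont _ z_bdd zcont _ b, of "y 0"])
    show "u p t \<bullet> b = y 0 \<bullet> b + fst p * integral {0..t} (poly (legendre_proj P s (\<lambda>t. f (u p t) \<bullet> b)))"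
      if "p \<in> I" "0 \<le> t" "t \<le> 1" "b \<in> Basis" for p t b
      unfolding u_def by (rule hbvm_curve_galerkin[OF P G f deg]) (use that in \<open>auto simp: I_def\<close>)
    show "z p t \<bullet> b = y 0 \<bullet> b + fst p * integral {0..t} (\<lambda>t. f (z p t) \<bullet> b)"
      if "p \<in> I" "0 \<le> t" "t \<le> 1" "b \<in> Basis" for p t b
      unfolding z_def by (rule rescaled_solution_integral[OF y]) (use that in \<open>auto simp: I_def\<close>)
  qed
  then have "\<forall>b\<in>Basis. \<exists>C. \<forall>p\<in>I. \<bar>(u p 1 - z p 1) \<bullet> b\<bar> \<le> C * fst p ^ (2 * s + 1)"
    unfolding unif_O_def by (meson atLeastAtMost_iff order_refl zero_le_one)
  then obtain C where C: "\<And>b p. b \<in> Basis \<Longrightarrow> p \<in> I \<Longrightarrow> \<bar>(u p 1 - z p 1) \<bullet> b\<bar> \<le> C b * fst p ^ (2 * s + 1)"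
    by metis
  have bound: "norm (rk_update k \<omega> f h (y 0) Y - y h) \<le> (\<Sum>b\<in>Basis. C b) * h ^ (2 * s + 1)"
    if "(h, Y) \<in> I" for h Y
  proof -
    have "norm (u (h, Y) 1 - z (h, Y) 1) \<le> (\<Sum>b\<in>Basis. \<bar>(u (h, Y) 1 - z (h, Y) 1) \<bullet> b\<bar>)"
      by (rule norm_le_l1)
    also have "\<dots> \<le> (\<Sum>b\<in>Basis. C b * h ^ (2 * s + 1))"
      using C[OF _ that] by (intro sum_mono) simp
    finally show ?thesis
      by (simp add: u_def z_def hbvm_curve_1[OF P s] sum_distrib_right)
  qed
  have "\<forall>\<^sub>F h in at_right (0::real). h \<in> {0<..<min 1 T}"
    by (rule eventually_at_right_real) (use T in simp)
  then have "\<forall>\<^sub>F h in at_right 0. \<forall>Y. rk_stages k (hbvm_matrix P c \<omega> s) f h (y 0) Y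
      \<and> (\<forall>i<k. dist (Y i) (y 0) \<le> R) \<longrightarrow>
      norm (rk_update k \<omega> f h (y 0) Y - y h) \<le> (\<Sum>b\<in>Basis. C b) * h ^ (2 * s + 1)"
  proof eventually_elim
    case (elim h)
    then show ?case by (intro allI impI bound) (auto simp: I_def)
  qed
  then show "\<exists>C. \<forall>\<^sub>F h in at_right 0. \<forall>Y. rk_stages k (hbvm_matrix P c \<omega> s) f h (y 0) Y
      \<and> (\<forall>i<k. dist (Y i) (y 0) \<le> R) \<longrightarrow>
      norm (rk_update k \<omega> f h (y 0) Y - y h) \<le> C * h ^ (2 * s + 1)"
    by blast
qed

section \<open>The Hamiltonian and its gradient\<close>

text \<open>
  Polynomials in \<open>y\<close> of degree at most \<open>d\<close> whose coefficients are continuous functions of the space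
  variable \<open>x\<close>.  Being finite sums of products, they may be integrated over \<open>x\<close> and differentiated
  in \<open>y\<close> under the integral term by term.
\<close>

inductive param_polyfun :: "nat \<Rightarrow> ('a::euclidean_space \<Rightarrow> real \<Rightarrow> real) \<Rightarrow> bool" for d where
  base: "continuous_on UNIV \<alpha> \<Longrightarrow> polyfun d g \<Longrightarrow> param_polyfun d (\<lambda>y x. \<alpha> x * g y)"
| add: "param_polyfun d F \<Longrightarrow> param_polyfun d G \<Longrightarrow> param_polyfun d (\<lambda>y x. F y x + G y x)"

lemma param_polyfun_mult:
  assumes "param_polyfun d F" "param_polyfun e G"
  shows "param_polyfun (d + e) (\<lambda>y x. F y x * G y x)"
  using assms(1)
proof (induction rule: param_polyfun.induct)
  case (base \<alpha> f)
  show ?case using assms(2)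
  proof (induction rule: param_polyfun.induct)
    case (base \<beta> g)
    have "param_polyfun (d + e) (\<lambda>y x. (\<alpha> x * \<beta> x) * (f y * g y))"
      using base \<open>continuous_on UNIV \<alpha>\<close> \<open>polyfun d f\<close>
      by (intro param_polyfun.base continuous_intros polyfun.mult)
    then show ?case by (simp add: mult_ac)
  next
    case (add F G)
    then show ?case using param_polyfun.add[OF add.IH] by (simp add: distrib_left)
  qed
next
  case (add F G)
  then show ?case using param_polyfun.add[OF add.IH] by (simp add: distrib_right)
qed

lemma param_polyfun_const: "param_polyfun d (\<lambda>y x. a)"
  using param_polyfun.base[of "\<lambda>_. a" d "\<lambda>_. 1", OF _ polyfun.const] by simp

lemma param_polyfun_cmult: "param_polyfun d F \<Longrightarrow> param_polyfun d (\<lambda>y x. a * F y x)"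
  using param_polyfun_mult[OF param_polyfun_const[of 0 a]] by simp

lemma param_polyfun_sum:
  "(\<And>i. i \<in> S \<Longrightarrow> param_polyfun d (F i)) \<Longrightarrow> param_polyfun d (\<lambda>y x. \<Sum>i\<in>S. F i y x)"
proof (induction S rule: infinite_finite_induct)
  case (insert i S)
  then show ?case by (simp add: param_polyfun.add)
qed (simp_all add: param_polyfun_const)

lemma param_polyfun_continuous: "param_polyfun d F \<Longrightarrow> continuous_on S (F y)"
proof (induction rule: param_polyfun.induct)
  case (base \<alpha> g)
  then show ?case by (intro continuous_intros continuous_on_subset[OF base(1)]) simp
qed (rule continuous_on_add)

lemma polyfun_integral:
  assumes "param_polyfun d F"
  shows "polyfun d (\<lambda>y. integral {a..b} (F y))"
  using assms
proof (induction rule: param_polyfun.induct)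
  case (base \<alpha> g)
  then show ?case using polyfun_cmult[of d g "integral {a..b} \<alpha>"] by simp
next
  case (add F G)
  have "integral {a..b} (\<lambda>x. F y x + G y x) = integral {a..b} (F y) + integral {a..b} (G y)" for y
    by (intro integral_add integrable_continuous_interval param_polyfun_continuous[OF add.hyps(1)]
          param_polyfun_continuous[OF add.hyps(2)])
  then show ?case using polyfun.add[OF add.IH] by simp
qed

text \<open>
  Differentiation under the integral sign.  It is clear for the derivative that the representation as a
  sum of products provides, and derivatives are unique.
\<close>

lemma param_polyfun_integral_has_derivative:
  assumes "param_polyfun d F"
    and F': "\<And>x. ((\<lambda>y. F y x) has_derivative F' x) (at z)"
  shows "((\<lambda>y. integral {a..b} (F y)) has_derivative (\<lambda>k. integral {a..b} (\<lambda>x. F' x k))) (at z)"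
proof -
  have "\<exists>D. (\<forall>x. ((\<lambda>y. F y x) has_derivative D x) (at z)) \<and> (\<forall>k. continuous_on {a..b} (\<lambda>x. D x k)) \<and>
      ((\<lambda>y. integral {a..b} (F y)) has_derivative (\<lambda>k. integral {a..b} (\<lambda>x. D x k))) (at z)"
    using assms(1)
  proof (induction rule: param_polyfun.induct)
    case (base \<alpha> g)
    obtain g' where g': "(g has_derivative g') (at z)"
      using differentiable_at_real_polynomial_function[OF polyfun_real_polynomial_function[OF base(2)]]
      by (auto simp: differentiable_def)
    have "((\<lambda>y. integral {a..b} \<alpha> * g y) has_derivative (\<lambda>k. integral {a..b} \<alpha> * g' k)) (at z)"
      by (intro derivative_intros g')
    moreover have "((\<lambda>y. \<alpha> x * g y) has_derivative (\<lambda>k. \<alpha> x * g' k)) (at z)" for x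
      by (intro derivative_intros g')
    moreover have "continuous_on {a..b} (\<lambda>x. \<alpha> x * g' k)" for k
      by (intro continuous_intros continuous_on_subset[OF base(1)]) simp
    ultimately show ?case by (intro exI[of _ "\<lambda>x k. \<alpha> x * g' k"]) simp
  next
    case (add F G)
    obtain D where D: "\<And>x. ((\<lambda>y. F y x) has_derivative D x) (at z)"
      "\<And>k. continuous_on {a..b} (\<lambda>x. D x k)"
      "((\<lambda>y. integral {a..b} (F y)) has_derivative (\<lambda>k. integral {a..b} (\<lambda>x. D x k))) (at z)"
      using add.IH(1) by blast
    obtain E where E: "\<And>x. ((\<lambda>y. G y x) has_derivative E x) (at z)"
      "\<And>k. continuous_on {a..b} (\<lambda>x. E x k)"
      "((\<lambda>y. integral {a..b} (G y)) has_derivative (\<lambda>k. integral {a..b} (\<lambda>x. E x k))) (at z)"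
      using add.IH(2) by blast
    have 1: "integral {a..b} (\<lambda>x. F y x + G y x) = integral {a..b} (F y) + integral {a..b} (G y)" for y
      by (intro integral_add integrable_continuous_interval param_polyfun_continuous[OF add.hyps(1)]
            param_polyfun_continuous[OF add.hyps(2)])
    have 2: "integral {a..b} (\<lambda>x. D x k + E x k)
        = integral {a..b} (\<lambda>x. D x k) + integral {a..b} (\<lambda>x. E x k)" for k
      by (intro integral_add integrable_continuous_interval D E)
    show ?case
    proof (intro exI[of _ "\<lambda>x k. D x k + E x k"] conjI allI)
      show "((\<lambda>y. F y x + G y x) has_derivative (\<lambda>k. D x k + E x k)) (at z)" for x
        by (intro derivative_intros D E)
      show "continuous_on {a..b} (\<lambda>x. D x k + E x k)" for k
        by (intro continuous_intros D E)
      show "((\<lambda>y. integral {a..b} (\<lambda>x. F y x + G y x)) has_derivative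
          (\<lambda>k. integral {a..b} (\<lambda>x. D x k + E x k))) (at z)"
        unfolding 1 2 by (intro derivative_intros D E)
    qed
  qed
  then obtain D where D: "\<And>x. ((\<lambda>y. F y x) has_derivative D x) (at z)"
      "((\<lambda>y. integral {a..b} (F y)) has_derivative (\<lambda>k. integral {a..b} (\<lambda>x. D x k))) (at z)"
    by blast
  have "D x = F' x" for x by (rule has_derivative_unique[OF D(1) F'])
  then show ?thesis using D(2) by simp
qed

text \<open>
  The value at \<open>x\<close> of component \<open>i\<close> of the truncated Fourier expansion with coefficients \<open>y\<close>.
\<close>

definition field_value ::
  "real \<Rightarrow> real \<Rightarrow> real^('m::finite bit1)^('n::finite \<times> 2) \<Rightarrow> 'n \<times> 2 \<Rightarrow> real \<Rightarrow> real" where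
  "field_value a b y i x = (y *v basis_w a b x) $ i"

text \<open>
  The squared modulus of the \<open>k\<close>-th complex wave function whose real and imaginary parts are the
  components \<open>(k, 1)\<close> and \<open>(k, 2)\<close>.  The matrix \<open>Q\<close> applied to the squares of the components yields
  these values, each of them twice.
\<close>

definition modulus_sq ::
  "real \<Rightarrow> real \<Rightarrow> real^('m::finite bit1)^('n::finite \<times> 2) \<Rightarrow> 'n \<Rightarrow> real \<Rightarrow> real" where
  "modulus_sq a b y k x = (field_value a b y (k, 1) x)\<^sup>2 + (field_value a b y (k, 2) x)\<^sup>2"

lemma sum_over_pairs: "(\<Sum>i\<in>(UNIV::('n::finite \<times> 2) set). g i) = (\<Sum>k\<in>UNIV. g (k, 1) + g (k, 2))"
  for g :: "'n::finite \<times> 2 \<Rightarrow> 'c::comm_monoid_add"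
proof -
  have "sum g UNIV = (\<Sum>k\<in>(UNIV::'n set). \<Sum>\<alpha>\<in>(UNIV::2 set). g (k, \<alpha>))"
    unfolding sum.cartesian_product by simp
  then show ?thesis by (simp add: sum_2)
qed

lemma field_value_sum: "field_value a b y i x = (\<Sum>j\<in>UNIV. y $ i $ j * basis_w a b x $ j)"
  by (simp add: field_value_def matrix_vector_mult_def)

lemma field_value_add: "field_value a b (y + z) i x = field_value a b y i x + field_value a b z i x"
  by (simp add: field_value_sum distrib_right sum.distrib)

lemma field_value_scaleR: "field_value a b (r *\<^sub>R y) i x = r * field_value a b y i x"
  by (simp add: field_value_sum sum_distrib_left mult.assoc)

lemma bounded_linear_field_value: "bounded_linear (\<lambda>y. field_value a b y i x)"
  by (intro linear_conv_bounded_linear[THEN iffD1] linearI)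
     (simp_all add: field_value_add field_value_scaleR)

lemma bounded_linear_entry: "bounded_linear (\<lambda>y :: real^'j::finite^'i::finite. y $ i $ j)"
  by (rule bounded_linear_compose[OF bounded_linear_vec_nth bounded_linear_vec_nth])

lemma continuous_on_basis_w [continuous_intros]: "continuous_on S (\<lambda>x. basis_w a b x $ j)"
proof -
  have "continuous_on S (\<lambda>x. 2 * pi * freq j * ((x - a) * inverse (b - a)))"
    by (intro continuous_intros)
  then show ?thesis
    by (cases "col_index j = 0"; cases "odd (col_index j)")
       (auto simp: basis_w_def divide_inverse
         intro!: continuous_on_mult_left continuous_on_sin continuous_on_cos)
qed

lemma param_polyfun_field_value: "param_polyfun 1 (\<lambda>y x. field_value a b y i x)"
proof -
  have "param_polyfun 1 (\<lambda>y x. \<Sum>j\<in>UNIV. basis_w a b x $ j * y $ i $ j)"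
    using polyfun.linear[OF bounded_linear_entry, of 0]
    by (intro param_polyfun_sum param_polyfun.base continuous_intros) simp
  then show ?thesis by (simp add: field_value_sum mult.commute)
qed

lemma param_polyfun_modulus_sq: "param_polyfun 2 (\<lambda>y x. modulus_sq a b y k x)"
proof -
  have "param_polyfun (1 + 1) (\<lambda>y x. field_value a b y i x * field_value a b y i x)" for i
    by (intro param_polyfun_mult param_polyfun_field_value)
  then show ?thesis
    unfolding modulus_sq_def power2_eq_square
    by (intro param_polyfun.add) (simp_all add: numeral_2_eq_2)
qed

lemma Qmat_mult_nth: "(Qmat *v u) $ i = u $ (fst i, 1) + u $ (fst i, 2)"
proof -
  obtain k \<alpha> where i: "i = (k, \<alpha>)" by (cases i)
  have "\<alpha> = 1 \<or> \<alpha> = 2" by (rule exhaust_2)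
  then have E: "(vector [vector [1, 1], vector [1, 1]] :: real^2^2) $ \<alpha> $ \<delta> = 1" if "\<delta> = 1 \<or> \<delta> = 2" for \<delta>
    using that by auto
  have "(Qmat *v u) $ i = (\<Sum>l\<in>UNIV. if k = l then u $ (l, 1) + u $ (l, 2) else 0)"
    unfolding matrix_vector_mult_def sum_over_pairs vec_lambda_beta
    by (intro sum.cong refl) (simp add: i Qmat_def kron_def mat_def E)
  then show ?thesis by (simp add: i)
qed

lemma Qmat_field_value_sq:
  "(Qmat *v (y *v basis_w a b x)\<^sup>2) $ i = modulus_sq a b y (fst i) x"
  by (simp add: Qmat_mult_nth modulus_sq_def field_value_def power2_eq_square)

lemma tensor_I2_mult_nth:
  "(tensor_I2 A *v u) $ i = (\<Sum>l\<in>UNIV. A $ fst i $ l * u $ (l, snd i))"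
proof -
  obtain k \<alpha> where i: "i = (k, \<alpha>)" by (cases i)
  have "(tensor_I2 A *v u) $ i = (\<Sum>q\<in>UNIV. A $ k $ fst q * (if \<alpha> = snd q then 1 else 0) * u $ q)"
    by (simp add: i matrix_vector_mult_def tensor_I2_def kron_def mat_def)
  also have "\<dots> = (\<Sum>l\<in>UNIV. \<Sum>\<delta>\<in>UNIV. A $ k $ l * (if \<alpha> = \<delta> then 1 else 0) * u $ (l, \<delta>))"
    unfolding sum.cartesian_product by (simp add: case_prod_unfold)
  also have "\<dots> = (\<Sum>l\<in>UNIV. A $ k $ l * u $ (l, \<alpha>))"
    by (intro sum.cong refl) (simp add: if_distrib[of "\<lambda>v. _ * v"] if_distrib[of "\<lambda>v. v * _"] cong: if_cong)
  finally show ?thesis by (simp add: i)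
qed

lemma tensor_I2_diag_mult_nth: "(tensor_I2 (diag_mat d) *v u) $ i = d $ fst i * u $ i"
proof -
  have "(tensor_I2 (diag_mat d) *v u) $ i
      = (\<Sum>l\<in>UNIV. if fst i = l then d $ l * u $ (l, snd i) else 0)"
    unfolding tensor_I2_mult_nth by (intro sum.cong) (auto simp: diag_mat_def)
  then show ?thesis by simp
qed

lemma hamiltonian_entries:
  "hamiltonian (diag_mat d) \<gamma> a b y =
     1/2 * (\<Sum>j\<in>UNIV. (dvec a b $ j)\<^sup>2 * (\<Sum>i\<in>UNIV. d $ fst i * (y $ i $ j)\<^sup>2))
     - 1/8 * integral {a..b} (\<lambda>x. 2 * (\<Sum>k\<in>UNIV. \<Sum>l\<in>UNIV.
         \<gamma> $ k $ l * (modulus_sq a b y k x * modulus_sq a b y l x)))"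
proof -
  have "column j y \<bullet> (tensor_I2 (diag_mat d) *v column j y) = (\<Sum>i\<in>UNIV. d $ fst i * (y $ i $ j)\<^sup>2)" for j
    by (simp add: inner_vec_def tensor_I2_diag_mult_nth column_def power2_eq_square mult_ac)
  moreover have "(Qmat *v (y *v basis_w a b x)\<^sup>2) \<bullet> (tensor_I2 \<gamma> *v (Qmat *v (y *v basis_w a b x)\<^sup>2))
      = 2 * (\<Sum>k\<in>UNIV. \<Sum>l\<in>UNIV. \<gamma> $ k $ l * (modulus_sq a b y k x * modulus_sq a b y l x))" for x
    unfolding inner_vec_def sum_over_pairs
    by (simp add: tensor_I2_mult_nth Qmat_field_value_sq sum_distrib_left mult_ac)
  ultimately show ?thesis by (simp add: hamiltonian_def)
qed

lemma grad_hamiltonian_entry: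
  fixes y :: "real^('m::finite bit1)^('n::finite \<times> 2)"
  shows "grad_hamiltonian (diag_mat d) \<gamma> a b y $ i $ j =
     d $ fst i * y $ i $ j * (dvec a b $ j)\<^sup>2
     - integral {a..b} (\<lambda>x. (\<Sum>l\<in>UNIV. \<gamma> $ fst i $ l * modulus_sq a b y l x)
         * field_value a b y i x * basis_w a b x $ j)"
proof -
  define g :: "real \<Rightarrow> real^('m bit1)^('n \<times> 2)" where
    "g x = (\<chi> i j. (\<Sum>l\<in>UNIV. \<gamma> $ fst i $ l * modulus_sq a b y l x)
         * field_value a b y i x * basis_w a b x $ j)" for x
  have g: "(\<lambda>x. outer (((tensor_I2 \<gamma> ** Qmat) *v (y *v basis_w a b x)\<^sup>2) * (y *v basis_w a b x))
      (basis_w a b x)) = g"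
    by (rule ext)
       (simp add: g_def outer_def vec_eq_iff tensor_I2_mult_nth Qmat_field_value_sq field_value_def
          flip: matrix_vector_mul_assoc)
  have "continuous_on {a..b} g"
    unfolding g_def
    by (intro continuous_on_vec_lambda continuous_intros
          param_polyfun_continuous[OF param_polyfun_modulus_sq]
          param_polyfun_continuous[OF param_polyfun_field_value])
  then have "g integrable_on {a..b}" by (rule integrable_continuous_interval)
  from integral_linear[OF this bounded_linear_entry[of i j]]
  have int: "integral {a..b} g $ i $ j = integral {a..b} (\<lambda>x. g x $ i $ j)"
    by (simp add: o_def)
  have "(tensor_I2 (diag_mat d) ** y ** (Dmat a b ** Dmat a b)) $ i $ j
      = d $ fst i * y $ i $ j * (dvec a b $ j)\<^sup>2"
  proof -
    have "(tensor_I2 (diag_mat d) ** y) $ i $ r = d $ fst i * y $ i $ r" for r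
      using tensor_I2_diag_mult_nth[of d "column r y" i]
      by (simp add: matrix_matrix_mult_def matrix_vector_mult_def column_def)
    moreover have "(Dmat a b ** Dmat a b) $ r $ j = (if r = j then (dvec a b $ j)\<^sup>2 else 0)" for r :: "'m bit1"
      by (auto simp: Dmat_def diag_mat_def matrix_matrix_mult_def power2_eq_square
            if_distrib[of "\<lambda>v. v * _"] cong: if_cong)
    ultimately show ?thesis
      by (simp add: matrix_matrix_mult_def[of _ "Dmat a b ** Dmat a b"] if_distrib[of "\<lambda>v. _ * v"] cong: if_cong)
  qed
  then show ?thesis
    by (simp add: grad_hamiltonian_def g int) (simp add: g_def)
qed

lemma polyfun_entry: "polyfun 1 (\<lambda>y :: real^'j::finite^'i::finite. y $ i $ j)"
  using polyfun.linear[OF bounded_linear_entry, of 0] by simp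

lemma param_polyfun_quartic:
  "param_polyfun 4 (\<lambda>y x. 2 * (\<Sum>k\<in>UNIV. \<Sum>l\<in>UNIV.
     \<gamma> $ k $ l * (modulus_sq a b y k x * modulus_sq a b y l x)))"
proof -
  have "param_polyfun (2 + 2) (\<lambda>y x. 2 * (\<Sum>k\<in>UNIV. \<Sum>l\<in>UNIV.
     \<gamma> $ k $ l * (modulus_sq a b y k x * modulus_sq a b y l x)))"
    by (intro param_polyfun_cmult param_polyfun_sum param_polyfun_mult param_polyfun_modulus_sq)
  then show ?thesis by simp
qed

lemma polyfun_hamiltonian: "polyfun 4 (hamiltonian (diag_mat d) \<gamma> a b)"
proof -
  have "polyfun (1 + 1) (\<lambda>y. y $ i $ j * y $ i $ j)" for i j
    by (intro polyfun.mult polyfun_entry)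
  then have "polyfun 4 (\<lambda>y. (y $ i $ j)\<^sup>2)" for i j
    unfolding power2_eq_square by (rule polyfun_mono) simp
  then show ?thesis
    unfolding hamiltonian_entries[abs_def]
    by (intro polyfun_diff polyfun_cmult polyfun_sum polyfun_integral param_polyfun_quartic)
qed

lemma polyfun_grad_hamiltonian: "polyfun 3 (\<lambda>y. grad_hamiltonian (diag_mat d) \<gamma> a b y $ i $ j)"
proof -
  have "param_polyfun (2 + 1 + 0) (\<lambda>y x. (\<Sum>l\<in>UNIV. \<gamma> $ fst i $ l * modulus_sq a b y l x)
         * field_value a b y i x * basis_w a b x $ j)"
    using param_polyfun.base[of "\<lambda>x. basis_w a b x $ j" 0 "\<lambda>_. 1", OF _ polyfun.const]
    by (intro param_polyfun_mult param_polyfun_sum param_polyfun_cmult param_polyfun_modulus_sq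
          param_polyfun_field_value) (simp add: continuous_intros)
  then have "polyfun 3 (\<lambda>y. integral {a..b} (\<lambda>x. (\<Sum>l\<in>UNIV. \<gamma> $ fst i $ l * modulus_sq a b y l x)
         * field_value a b y i x * basis_w a b x $ j))"
    by (intro polyfun_integral) simp
  moreover have "polyfun 3 (\<lambda>y. (d $ fst i * (dvec a b $ j)\<^sup>2) * y $ i $ j)"
    by (intro polyfun_cmult polyfun_mono[OF polyfun_entry]) simp
  ultimately show ?thesis
    unfolding grad_hamiltonian_entry using polyfun_diff by (fastforce simp: mult_ac)
qed

lemma Jmat_mult_nth:
  "(Jmat ** z) $ (k, 1) $ j = z $ (k, 2) $ j" "(Jmat ** z) $ (k, 2) $ j = - z $ (k, 1) $ j"
  by (simp_all add: matrix_matrix_mult_def Jmat_def kron_def J2_def mat_def sum_over_pairs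
        if_distrib[of "\<lambda>v. v * _"] sum_negf cong: if_cong)

lemma Jmat_skew: "z \<bullet> (Jmat ** z) = 0"
  unfolding inner_vec_def sum_over_pairs by (simp add: inner_vec_def Jmat_mult_nth mult.commute sum_negf)

lemma linear_Jmat_mult: "linear (\<lambda>z. Jmat ** z)"
  by (rule linearI)
     (simp_all add: vec_eq_iff matrix_matrix_mult_def sum_distrib_left distrib_left sum.distrib mult_ac)

lemma polyfun_ham_field:
  fixes v :: "real^('m::finite bit1)^('n::finite \<times> 2)"
  shows "polyfun 3 (\<lambda>y. ham_field (diag_mat d) \<gamma> a b y \<bullet> v)"
proof -
  have "polyfun 3 (\<lambda>y. \<Sum>i\<in>UNIV. \<Sum>j\<in>UNIV. v $ i $ j *
      (\<Sum>r\<in>UNIV. Jmat $ i $ r * grad_hamiltonian (diag_mat d) \<gamma> a b y $ r $ j))"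
    by (intro polyfun_sum polyfun_cmult polyfun_grad_hamiltonian)
  then show ?thesis
    by (simp add: ham_field_def inner_vec_def matrix_matrix_mult_def mult.commute)
qed

lemma modulus_sq_has_derivative:
  "((\<lambda>y. modulus_sq a b y k x) has_derivative
     (\<lambda>\<eta>. 2 * (field_value a b z (k, 1) x * field_value a b \<eta> (k, 1) x
             + field_value a b z (k, 2) x * field_value a b \<eta> (k, 2) x))) (at z)"
  unfolding modulus_sq_def
  by (auto intro!: derivative_eq_intros bounded_linear_imp_has_derivative[OF bounded_linear_field_value])

text \<open>
  The quadratic part is diagonal.  The quartic part is a quadratic form with matrix \<open>\<gamma>\<close> in the squared
  moduli; \<open>\<gamma>\<close> being symmetric, both factors contribute equally to its derivative.  The factor \<open>8\<close> that
  cancels \<open>1/8\<close> is made up of \<open>2\<close> for the duplication by \<open>Q\<close>, \<open>2\<close> for the two factors and \<open>2\<close> for the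
  derivative of a square.
\<close>

lemma gderiv_hamiltonian:
  fixes z :: "real^('m::finite bit1)^('n::finite \<times> 2)"
  assumes sym: "\<gamma> = transpose \<gamma>"
  shows "GDERIV (hamiltonian (diag_mat d) \<gamma> a b) z :> grad_hamiltonian (diag_mat d) \<gamma> a b z"
proof -
  define \<mu> where "\<mu> k x = modulus_sq a b z k x" for k x
  define D\<mu> :: "'n \<Rightarrow> real \<Rightarrow> real^('m bit1)^('n \<times> 2) \<Rightarrow> real" where
    "D\<mu> k x \<eta> = 2 * (field_value a b z (k, 1) x * field_value a b \<eta> (k, 1) x
             + field_value a b z (k, 2) x * field_value a b \<eta> (k, 2) x)" for k x \<eta>
  define G :: "real^('m bit1)^('n \<times> 2) \<Rightarrow> real \<Rightarrow> real" where
    "G \<eta> x = (\<Sum>i\<in>UNIV. (\<Sum>l\<in>UNIV. \<gamma> $ fst i $ l * \<mu> l x)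
      * field_value a b z i x * field_value a b \<eta> i x)" for \<eta> x
  have quad: "((\<lambda>y :: real^('m bit1)^('n \<times> 2).
        1/2 * (\<Sum>j\<in>UNIV. (dvec a b $ j)\<^sup>2 * (\<Sum>i\<in>UNIV. d $ fst i * (y $ i $ j)\<^sup>2))) has_derivative
      (\<lambda>\<eta>. \<Sum>j\<in>UNIV. (dvec a b $ j)\<^sup>2 * (\<Sum>i\<in>UNIV. d $ fst i * (z $ i $ j * \<eta> $ i $ j)))) (at z)"
    by (auto intro!: derivative_eq_intros bounded_linear_imp_has_derivative[OF bounded_linear_entry]
          simp: sum_distrib_left mult_ac)
  have "((\<lambda>y :: real^('m bit1)^('n \<times> 2).
        2 * (\<Sum>k\<in>UNIV. \<Sum>l\<in>UNIV. \<gamma> $ k $ l * (modulus_sq a b y k x * modulus_sq a b y l x)))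
      has_derivative (\<lambda>\<eta>. 2 * (\<Sum>k\<in>UNIV. \<Sum>l\<in>UNIV. \<gamma> $ k $ l * (\<mu> k x * D\<mu> l x \<eta> + D\<mu> k x \<eta> * \<mu> l x)))) (at z)" for x
    unfolding \<mu>_def D\<mu>_def
    by (intro has_derivative_mult_right has_derivative_sum has_derivative_mult modulus_sq_has_derivative)
  from param_polyfun_integral_has_derivative[OF param_polyfun_quartic this]
  have int: "((\<lambda>y :: real^('m bit1)^('n \<times> 2). integral {a..b} (\<lambda>x. 2 * (\<Sum>k\<in>UNIV. \<Sum>l\<in>UNIV.
          \<gamma> $ k $ l * (modulus_sq a b y k x * modulus_sq a b y l x)))) has_derivative
      (\<lambda>\<eta>. integral {a..b} (\<lambda>x. 2 * (\<Sum>k\<in>UNIV. \<Sum>l\<in>UNIV.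
          \<gamma> $ k $ l * (\<mu> k x * D\<mu> l x \<eta> + D\<mu> k x \<eta> * \<mu> l x))))) (at z)" .
  have quartic: "2 * (\<Sum>k\<in>UNIV. \<Sum>l\<in>UNIV. \<gamma> $ k $ l * (\<mu> k x * D\<mu> l x \<eta> + D\<mu> k x \<eta> * \<mu> l x))
      = 8 * G \<eta> x" for x \<eta>
  proof -
    let ?S = "\<Sum>k\<in>UNIV. \<Sum>l\<in>UNIV. \<gamma> $ k $ l * (D\<mu> k x \<eta> * \<mu> l x)"
    have \<gamma>: "\<gamma> $ k $ l = \<gamma> $ l $ k" for k l
      using arg_cong[OF sym, of "\<lambda>A. A $ k $ l"] by (simp add: transpose_def)
    have "(\<Sum>k\<in>UNIV. \<Sum>l\<in>UNIV. \<gamma> $ k $ l * (\<mu> k x * D\<mu> l x \<eta>)) = ?S"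
      by (subst sum.swap, intro sum.cong refl, subst \<gamma>) (simp add: mult_ac)
    then have "(\<Sum>k\<in>UNIV. \<Sum>l\<in>UNIV. \<gamma> $ k $ l * (\<mu> k x * D\<mu> l x \<eta> + D\<mu> k x \<eta> * \<mu> l x)) = 2 * ?S"
      by (simp add: distrib_left sum.distrib)
    moreover have "?S = 2 * G \<eta> x"
      unfolding G_def sum_over_pairs
      by (simp add: D\<mu>_def sum_distrib_left sum_distrib_right sum.distrib distrib_left distrib_right mult_ac)
    ultimately show ?thesis by simp
  qed
  have "\<eta> \<bullet> grad_hamiltonian (diag_mat d) \<gamma> a b z =
      (\<Sum>j\<in>UNIV. (dvec a b $ j)\<^sup>2 * (\<Sum>i\<in>UNIV. d $ fst i * (z $ i $ j * \<eta> $ i $ j)))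
      - integral {a..b} (G \<eta>)" for \<eta>
  proof -
    let ?g = "\<lambda>i j x. (\<Sum>l\<in>UNIV. \<gamma> $ fst i $ l * \<mu> l x) * field_value a b z i x * basis_w a b x $ j"
    have cont: "continuous_on {a..b} (?g i j)" for i j
      unfolding \<mu>_def
      by (intro continuous_intros param_polyfun_continuous[OF param_polyfun_modulus_sq]
            param_polyfun_continuous[OF param_polyfun_field_value])
    have "integral {a..b} (G \<eta>)
        = integral {a..b} (\<lambda>x. \<Sum>i\<in>UNIV. \<Sum>j\<in>UNIV. \<eta> $ i $ j *\<^sub>R ?g i j x)"
    proof (intro arg_cong[where f = "integral {a..b}"] ext)
      fix x
      show "G \<eta> x = (\<Sum>i\<in>UNIV. \<Sum>j\<in>UNIV. \<eta> $ i $ j *\<^sub>R ?g i j x)"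
        unfolding G_def field_value_sum[of a b \<eta>] sum_distrib_left[of "_ * field_value a b z _ x"]
        by (intro sum.cong refl) (simp add: mult_ac)
    qed
    also have "\<dots> = (\<Sum>i\<in>UNIV. integral {a..b} (\<lambda>x. \<Sum>j\<in>UNIV. \<eta> $ i $ j *\<^sub>R ?g i j x))"
      by (intro integral_sum integrable_continuous_interval continuous_on_sum continuous_on_scaleR
            continuous_on_const cont finite)
    also have "\<dots> = (\<Sum>i\<in>UNIV. \<Sum>j\<in>UNIV. integral {a..b} (\<lambda>x. \<eta> $ i $ j *\<^sub>R ?g i j x))"
      by (intro sum.cong refl integral_sum integrable_continuous_interval continuous_on_scaleR
            continuous_on_const cont finite)
    also have "\<dots> = (\<Sum>i\<in>UNIV. \<Sum>j\<in>UNIV. \<eta> $ i $ j * integral {a..b} (?g i j))"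
      by (intro sum.cong refl) (simp only: integral_mult_right real_scaleR_def)
    finally have G: "integral {a..b} (G \<eta>) = \<dots>" .
    have "\<eta> \<bullet> grad_hamiltonian (diag_mat d) \<gamma> a b z
        = (\<Sum>i\<in>UNIV. \<Sum>j\<in>UNIV. (dvec a b $ j)\<^sup>2 * (d $ fst i * (z $ i $ j * \<eta> $ i $ j)))
        - (\<Sum>i\<in>UNIV. \<Sum>j\<in>UNIV. \<eta> $ i $ j * integral {a..b} (?g i j))"
      unfolding sum_subtractf[symmetric] inner_vec_def inner_real_def grad_hamiltonian_entry \<mu>_def
      by (intro sum.cong refl) (simp add: right_diff_distrib mult_ac)
    also have "(\<Sum>i\<in>UNIV. \<Sum>j\<in>UNIV. (dvec a b $ j)\<^sup>2 * (d $ fst i * (z $ i $ j * \<eta> $ i $ j)))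
        = (\<Sum>j\<in>UNIV. (dvec a b $ j)\<^sup>2 * (\<Sum>i\<in>UNIV. d $ fst i * (z $ i $ j * \<eta> $ i $ j)))"
      by (subst sum.swap) (simp add: sum_distrib_left)
    finally show ?thesis by (simp only: G)
  qed
  then show ?thesis
    unfolding gderiv_def hamiltonian_entries[abs_def]
    using has_derivative_diff[OF quad has_derivative_mult_right[OF int, of "1/8"]]
    by (simp add: quartic)
qed

theorem corollary3:
  fixes \<beta>d :: "real^'n" and \<beta> \<gamma> :: "real^'n^'n" and a b T :: real
    and y :: "real \<Rightarrow> real^('m::finite bit1)^('n \<times> 2)"
    and y0 :: "real^('m bit1)^('n \<times> 2)"
    and P :: "nat \<Rightarrow> real poly" and c \<omega> :: "nat \<Rightarrow> real" and s :: nat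
  assumes "a < b" and "0 < T"
    and "\<beta> = diag_mat \<beta>d" and "\<gamma> = transpose \<gamma>"
    and "y 0 = y0"
    and "\<And>t. t \<in> {0..T} \<Longrightarrow>
           (y has_vector_derivative ham_field \<beta> \<gamma> a b (y t)) (at t within {0..T})"
    and "s \<ge> 1"
    and "orthonormal_legendre P" and "gauss_legendre P (2 * s) c \<omega>"
  shows "(\<forall>z :: real^('m bit1)^('n \<times> 2).
            GDERIV (hamiltonian \<beta> \<gamma> a b) z :> grad_hamiltonian \<beta> \<gamma> a b z)
       \<and> energy_conserving (2 * s) (hbvm_matrix P c \<omega> s) \<omega>
            (ham_field \<beta> \<gamma> a b :: real^('m bit1)^('n \<times> 2) \<Rightarrow> _) (hamiltonian \<beta> \<gamma> a b)
       \<and> rk_order (2 * s) (hbvm_matrix P c \<omega> s) \<omega> (ham_field \<beta> \<gamma> a b) y (2 * s)"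
proof (intro conjI allI)
  show grad: "GDERIV (hamiltonian \<beta> \<gamma> a b) z :> grad_hamiltonian \<beta> \<gamma> a b z"
    for z :: "real^('m bit1)^('n \<times> 2)"
    unfolding assms(3) by (rule gderiv_hamiltonian[OF assms(4)])
  have H: "polyfun 4 (hamiltonian \<beta> \<gamma> a b :: real^('m bit1)^('n \<times> 2) \<Rightarrow> real)"
    unfolding assms(3) by (rule polyfun_hamiltonian)
  show "energy_conserving (2 * s) (hbvm_matrix P c \<omega> s) \<omega>
      (ham_field \<beta> \<gamma> a b :: real^('m bit1)^('n \<times> 2) \<Rightarrow> _) (hamiltonian \<beta> \<gamma> a b)"
    unfolding ham_field_def[abs_def]
    by (rule hbvm_energy_conserving[OF assms(8,9,7) _ H _ grad linear_Jmat_mult Jmat_skew])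
       (use assms(7) in simp_all)
  show "rk_order (2 * s) (hbvm_matrix P c \<omega> s) \<omega> (ham_field \<beta> \<gamma> a b) y (2 * s)"
  proof (rule hbvm_order[OF assms(8,9,7) _ _ assms(2,6)])
    show "polyfun 3 (\<lambda>y :: real^('m bit1)^('n \<times> 2). ham_field \<beta> \<gamma> a b y \<bullet> v)" for v
      unfolding assms(3) by (rule polyfun_ham_field)
  qed simp_all
qed

end
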